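(* Let $\mathscr{D} = \bigl( (\ell_j)_{j\in J}, (q_j)_{j\in J} \bigr)$ be a Brascamp-Lieb datum, with linear maps $\ell_j:H\to H_j$. Set $C:=1+\sup_{j\in J} \|\ell_{j}\|$, where $\|\cdot\|$ is the operator norm. Let $\mathbf{R} = (\operatorname{id}_{H_j})_{j \in J}$ and $T = t \operatorname{id}_H$ for some $t>0$. Then for all $\alpha \in (0, 1]$ and all linear subspaces $W \subseteq H$, we have \[ \operatorname{BL}( \mathscr{D}, \mathbf{R}, T) \geq \Bigl( (C/\alpha)^2 t+ C^2\sum_{j \in J} q_j \Bigr)^{-\dim H / 2} \alpha^{\sum_{j \in J} q_j \operatorname{rk}_{\alpha}(\ell_j \mid W) - \dim W}. \]
   Context: A Euclidean space is a finite-dimensional real Hilbert space, equipped with the Lebesgue measure induced by its inner product. A Brascamp-Lieb datum $\mathscr{D}=((\ell_j)_{j\in J},(q_j)_{j\in J})$ consists of a finite index set $J$, Euclidean spaces $H$ and $H_j$ ($j\in J$), linear maps $\ell_j:H\to H_j$, and real numbers $q_j>0$. For a positive definite symmetric endomorphism $R$ of a Euclidean space $E$ and $x\in E$, set $\chi_R(x)=e^{-\pi\langle x,Rx\rangle}$ and $\mathscr{N}_R(x)=(\det R)^{1/2}\chi_R(x)$. A function $f:E\to\mathbb{R}_{\ge0}$ is of type $R$ if $f=\mathscr{N}_R*\mu$ for some finite (positive) Borel measure $\mu$ on $E$. For $\mathbf{R}=(R_j)_{j\in J}$ with each $R_j$ a positive definite symmetric endomorphism of $H_j$, and $T$ a positive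 definite symmetric endomorphism of $H$, $\operatorname{BL}(\mathscr{D},\mathbf{R},T)\in[0,+\infty]$ is the smallest number such that \[ \int_{H} \chi_T \prod_{j \in J} (f_{j}\circ \ell_{j})^{q_{j}} \leq \operatorname{BL}(\mathscr{D}, \mathbf{R}, T) \prod_{j \in J} \Bigl(\int_{H_{j}} f_{j} \Bigr)^{q_{j}} \] for all collections $(f_j)_{j\in J}$ such that $f_j:H_j\to\mathbb{R}_{\ge0}$ is of type $R_j$ for each $j\in J$. For a linear map $\ell:H\to H'$ between Euclidean spaces and $\alpha\ge0$, the $\alpha$-essential rank $\operatorname{rk}_\alpha(\ell)$ is the number (counted with multiplicity) of singular values of $\ell$ that are strictly greater than $\alpha$. For a subspace $W\subseteq H$, $\operatorname{rk}_\alpha(\ell\mid W):=\operatorname{rk}_\alpha(\ell_{|W})$, where $\ell_{|W}:W\to H'$ is the restriction. *)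

theory Defs
  imports "HOL-Analysis.Analysis"
begin

text \<open>
  A Euclidean space is represented by a linear subspace of a type of class
  \<^class>\<open>euclidean_space\<close>, with the induced inner product. This includes the zero space, and it
  lets the spaces $H_j$ of a finite family have different dimensions inside a single type.
\<close>

definition onb :: "'a::euclidean_space set \<Rightarrow> 'a set" where
  "onb E = (SOME B. B \<subseteq> E \<and> pairwise orthogonal B \<and> (\<forall>b\<in>B. norm b = 1) \<and>
                    independent B \<and> finite B \<and> span B = E)"

lemma onb:
  fixes E :: "'a::euclidean_space set"
  assumes "subspace E"
  shows "onb E \<subseteq> E" "pairwise orthogonal (onb E)" "\<And>b. b \<in> onb E \<Longrightarrow> norm b = 1"
    "independent (onb E)" "finite (onb E)" "span (onb E) = E" "card (onb E) = dim E"
proof -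
  have "\<exists>B. B \<subseteq> E \<and> pairwise orthogonal B \<and> (\<forall>b\<in>B. norm b = 1) \<and>
            independent B \<and> finite B \<and> span B = E"
    by (rule orthonormal_basis_subspace[OF assms]) (metis independent_imp_finite)
  then have *: "onb E \<subseteq> E \<and> pairwise orthogonal (onb E) \<and> (\<forall>b\<in>onb E. norm b = 1) \<and>
            independent (onb E) \<and> finite (onb E) \<and> span (onb E) = E"
    unfolding onb_def by (rule someI_ex)
  then show "onb E \<subseteq> E" "pairwise orthogonal (onb E)" "\<And>b. b \<in> onb E \<Longrightarrow> norm b = 1"
    "independent (onb E)" "finite (onb E)" "span (onb E) = E" by auto
  then show "card (onb E) = dim E" by (metis dim_span_eq_card_independent)
qed

text \<open>
  Lebesgue measure on $E$ (on its Borel sets) and the determinant of an endomorphism of $E$ are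
  taken in the coordinates of an orthonormal basis; neither depends on which one is chosen.
  On the zero space the measure is the unit mass at $0$ and the determinant is $1$.
\<close>

definition lebesgue_sub :: "'a::euclidean_space set \<Rightarrow> 'a measure" where
  "lebesgue_sub E = distr (\<Pi>\<^sub>M b\<in>onb E. lborel) (restrict_space borel E)
                          (\<lambda>c. \<Sum>b\<in>onb E. c b *\<^sub>R b)"

definition det_sub :: "'a::euclidean_space set \<Rightarrow> ('a \<Rightarrow> 'a) \<Rightarrow> real" where
  "det_sub E R = (\<Sum>p | p permutes onb E. of_int (sign p) * (\<Prod>b\<in>onb E. b \<bullet> R (p b)))"

definition linear_sub ::
  "'a::euclidean_space set \<Rightarrow> 'b::euclidean_space set \<Rightarrow> ('a \<Rightarrow> 'b) \<Rightarrow> bool" where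
  "linear_sub E F f \<longleftrightarrow> f \<in> E \<rightarrow> F \<and>
     (\<forall>x\<in>E. \<forall>y\<in>E. f (x + y) = f x + f y) \<and> (\<forall>c. \<forall>x\<in>E. f (c *\<^sub>R x) = c *\<^sub>R f x)"

text \<open>The following two are relativised forms of \<^const>\<open>onorm\<close> and \<^const>\<open>adjoint\<close>.\<close>

definition onorm_sub :: "'a::euclidean_space set \<Rightarrow> ('a \<Rightarrow> 'b::euclidean_space) \<Rightarrow> real" where
  "onorm_sub E f = (SUP x\<in>E. norm (f x) / norm x)"

definition adjoint_sub ::
  "'a::euclidean_space set \<Rightarrow> 'b::euclidean_space set \<Rightarrow> ('a \<Rightarrow> 'b) \<Rightarrow> 'b \<Rightarrow> 'a" where
  "adjoint_sub E F f = (SOME g. \<forall>y\<in>F. g y \<in> E \<and> (\<forall>x\<in>E. f x \<bullet> y = x \<bullet> g y))"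

text \<open>
  The singular values of $f : E \to F$ are the square roots of the eigenvalues of $f^* f$, and
  the multiplicity of a singular value is the dimension of the corresponding eigenspace.
\<close>

definition singular_space ::
  "'a::euclidean_space set \<Rightarrow> 'b::euclidean_space set \<Rightarrow> ('a \<Rightarrow> 'b) \<Rightarrow> real \<Rightarrow> 'a set" where
  "singular_space E F f s = {x \<in> E. adjoint_sub E F f (f x) = s\<^sup>2 *\<^sub>R x}"

definition singular_values ::
  "'a::euclidean_space set \<Rightarrow> 'b::euclidean_space set \<Rightarrow> ('a \<Rightarrow> 'b) \<Rightarrow> real set" where
  "singular_values E F f = {s. 0 \<le> s \<and> (\<exists>x\<in>singular_space E F f s. x \<noteq> 0)}"

definition essential_rank ::
  "real \<Rightarrow> 'a::euclidean_space set \<Rightarrow> 'b::euclidean_space set \<Rightarrow> ('a \<Rightarrow> 'b) \<Rightarrow> nat" where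
  "essential_rank \<alpha> E F f = (\<Sum>s | s \<in> singular_values E F f \<and> s > \<alpha>. dim (singular_space E F f s))"

definition gauss_chi :: "('a::euclidean_space \<Rightarrow> 'a) \<Rightarrow> 'a \<Rightarrow> real" where
  "gauss_chi R x = exp (- pi * (x \<bullet> R x))"

definition gauss_normal :: "'a::euclidean_space set \<Rightarrow> ('a \<Rightarrow> 'a) \<Rightarrow> 'a \<Rightarrow> real" where
  "gauss_normal E R x = sqrt (det_sub E R) * gauss_chi R x"

definition of_type :: "'a::euclidean_space set \<Rightarrow> ('a \<Rightarrow> 'a) \<Rightarrow> ('a \<Rightarrow> real) \<Rightarrow> bool" where
  "of_type E R f \<longleftrightarrow> (\<exists>\<mu>. finite_measure \<mu> \<and> sets \<mu> = sets (restrict_space borel E) \<and>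
     (\<forall>x\<in>E. f x = (\<integral>y. gauss_normal E R (x - y) \<partial>\<mu>)))"

definition brascamp_lieb_datum ::
  "'j set \<Rightarrow> 'a::euclidean_space set \<Rightarrow> ('j \<Rightarrow> 'b::euclidean_space set) \<Rightarrow>
   ('j \<Rightarrow> 'a \<Rightarrow> 'b) \<Rightarrow> ('j \<Rightarrow> real) \<Rightarrow> bool" where
  "brascamp_lieb_datum J H K l q \<longleftrightarrow> finite J \<and> subspace H \<and>
     (\<forall>j\<in>J. subspace (K j) \<and> linear_sub H (K j) (l j) \<and> q j > 0)"

text \<open>Only used with positive exponents, hence the value at \<^term>\<open>top::ennreal\<close>.\<close>

definition ennreal_powr :: "ennreal \<Rightarrow> real \<Rightarrow> ennreal" where
  "ennreal_powr x q = (if x = top then top else ennreal (enn2real x powr q))"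

text \<open>
  The convention \<^term>\<open>top * 0 = (0::ennreal)\<close> does no harm: functions of a given type have finite
  integral, and the right-hand side below vanishes only if some $f_j$ vanishes identically, in
  which case the left-hand side does as well. So the infimum is attained.
\<close>

definition brascamp_lieb_const ::
  "'j set \<Rightarrow> 'a::euclidean_space set \<Rightarrow> ('j \<Rightarrow> 'b::euclidean_space set) \<Rightarrow>
   ('j \<Rightarrow> 'a \<Rightarrow> 'b) \<Rightarrow> ('j \<Rightarrow> real) \<Rightarrow> ('j \<Rightarrow> 'b \<Rightarrow> 'b) \<Rightarrow> ('a \<Rightarrow> 'a) \<Rightarrow> ennreal" where
  "brascamp_lieb_const J H K l q R T = Inf {c. \<forall>f. (\<forall>j\<in>J. of_type (K j) (R j) (f j)) \<longrightarrow>
     (\<integral>\<^sup>+x. ennreal (gauss_chi T x * (\<Prod>j\<in>J. f j (l j x) powr q j)) \<partial>lebesgue_sub H)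
       \<le> c * (\<Prod>j\<in>J. ennreal_powr (\<integral>\<^sup>+y. ennreal (f j y) \<partial>lebesgue_sub (K j)) (q j))}"

end

theory Submission
  imports Defs "HOL-Probability.Distributions"
begin

text \<open>
  Test the inequality on Gaussians. Let $W_1 \subseteq W$ be the sum of the singular spaces of
  $\ell_j|_W$ for the singular values above $\alpha$, let $P_j$ be the orthogonal projection onto
  $\ell_j(W_1)$, and put $D_j = \alpha P_j + (1 - P_j)$. As $D_j \le 1$, the function
  $f_j(y) = e^{-\pi |D_j y|^2}$ is of type $\mathrm{id}$, and its mass is $\alpha^{-\dim \ell_j(W_1)}$,
  where $\dim \ell_j(W_1)$ is at most the essential rank. With $S = \alpha$ on $W$ and $S = 1$ on
  its complement,
  $|D_j \ell_j x| \le (1 + \|\ell_j\|)\,|S x|$ and $|x| \le \alpha^{-1} |S x|$, so the integrand on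
  the left is at least $e^{-\pi M |S x|^2}$ with $M = (C/\alpha)^2 t + C^2 \sum_j q_j$, whose integral
  is $M^{-\dim H / 2} \alpha^{-\dim W}$.
\<close>

subsection \<open>Gaussians on a subspace\<close>

text \<open>The map S is the same for all j, while W_1 depends on j. Shrinking the target along the
  whole image of W would cost dim l_j(W) in the mass, possibly more than the essential rank; the
  rest of W is not shrunk in the target because l_j already contracts it by the factor \<alpha>.
  That rest is what the summand 1 in C pays for. The main obstacle is that the image of the
  complement of W can lean into l_j(W_1), so a termwise estimate of D_j l_j x loses a constant
  factor; averaging with a reflection avoids the loss. Because \<alpha> is at most 1, a smaller
  dimension of l_j(W_1) only improves the ratio of the two sides, so an upper bound on it suffices.
  The test Gaussians are diagonal in bases adapted to these subspaces, whereas
  \<open>lebesgue_sub\<close> is built on the fixed choice \<open>onb\<close>. Hence the predicate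
  below for arbitrary orthonormal bases, and the detour through basis independence.\<close>

definition orthonormal_basis_of :: "'a::euclidean_space set \<Rightarrow> 'a set \<Rightarrow> bool" where
  "orthonormal_basis_of E B \<longleftrightarrow>
     pairwise orthogonal B \<and> (\<forall>b\<in>B. norm b = 1) \<and> finite B \<and> span B = E"

lemma orthonormal_basis_of_onb: "subspace E \<Longrightarrow> orthonormal_basis_of E (onb E)"
  by (simp add: orthonormal_basis_of_def onb)

context
  fixes E B :: "'a::euclidean_space set"
  assumes B: "orthonormal_basis_of E B"
begin

lemma onb_finite: "finite B"
  using B by (simp add: orthonormal_basis_of_def)

lemma onb_subset: "B \<subseteq> E"
  using B span_superset[of B] by (simp add: orthonormal_basis_of_def)

lemma onb_subspace: "subspace E"
  using B subspace_span[of B] by (simp add: orthonormal_basis_of_def)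

lemma onb_inner: "a \<in> B \<Longrightarrow> b \<in> B \<Longrightarrow> a \<bullet> b = (if a = b then 1 else 0)"
  using B by (auto simp: orthonormal_basis_of_def pairwise_def orthogonal_def norm_eq_1)

lemma onb_expand: "x \<in> E \<Longrightarrow> (\<Sum>b\<in>B. (x \<bullet> b) *\<^sub>R b) = x"
  using B by (auto simp: orthonormal_basis_of_def intro!: orthonormal_basis_expand)

lemma onb_sum_in: "(\<Sum>b\<in>B. c b *\<^sub>R b) \<in> E"
  using onb_subset onb_subspace by (auto intro!: subspace_sum subspace_scale)

lemma onb_sum_inner: "b \<in> B \<Longrightarrow> (\<Sum>b\<in>B. c b *\<^sub>R b) \<bullet> b = c b"
  using onb_finite by (simp add: inner_sum_left onb_inner if_distrib cong: if_cong)

lemma onb_sum_norm: "(norm (\<Sum>b\<in>B. c b *\<^sub>R b))\<^sup>2 = (\<Sum>b\<in>B. (c b)\<^sup>2)"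
  unfolding power2_norm_eq_inner
  by (subst inner_sum_right) (simp add: onb_sum_inner power2_eq_square)

lemma onb_norm: "x \<in> E \<Longrightarrow> (norm x)\<^sup>2 = (\<Sum>b\<in>B. (x \<bullet> b)\<^sup>2)"
  using onb_sum_norm[of "\<lambda>b. x \<bullet> b"] by (simp add: onb_expand)

lemma onb_independent: "independent B"
proof (rule pairwise_orthogonal_independent)
  show "pairwise orthogonal B" using B by (simp add: orthonormal_basis_of_def)
  show "0 \<notin> B" using onb_inner[of 0 0] by auto
qed

lemma onb_card: "card B = dim E"
proof -
  have "span B = E" using B by (simp add: orthonormal_basis_of_def)
  then show ?thesis using dim_span_eq_card_independent[OF onb_independent] by simp
qed

end

text \<open>A permutation other than the identity moves some basis vector, and orthogonality then
  kills its term of the Leibniz sum.\<close>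

lemma det_sub_id:
  assumes "subspace E"
  shows "det_sub E id = 1"
proof -
  note B = orthonormal_basis_of_onb[OF assms]
  have "det_sub E id = (\<Sum>p | p permutes onb E. if p = id then 1 else 0)"
    unfolding det_sub_def
  proof (rule sum.cong[OF refl])
    fix p assume "p \<in> {p. p permutes onb E}"
    then have p: "p permutes onb E" by simp
    show "of_int (sign p) * (\<Prod>b\<in>onb E. b \<bullet> id (p b)) = (if p = id then 1 else 0 :: real)"
    proof (cases "p = id")
      case True
      then show ?thesis by (simp add: onb_inner[OF B] cong: prod.cong)
    next
      case False
      then obtain b where "p b \<noteq> b" by (metis eq_id_iff)
      with p have "b \<in> onb E" "p b \<in> onb E"
        by (metis permutes_not_in, metis permutes_not_in permutes_in_image)
      with \<open>p b \<noteq> b\<close> have "b \<bullet> p b = 0" by (simp add: onb_inner[OF B])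
      with \<open>b \<in> onb E\<close> False show ?thesis
        using onb_finite[OF B] by (auto simp: prod_zero_iff)
    qed
  qed
  also have "\<dots> = 1"
    using onb_finite[OF B] by (simp add: permutes_id finite_permutations del: id_apply)
  finally show ?thesis .
qed

lemma gauss_normal_id: "subspace E \<Longrightarrow> gauss_normal E id x = exp (- pi * (norm x)\<^sup>2)"
  by (simp add: gauss_normal_def gauss_chi_def det_sub_id power2_norm_eq_inner)

section \<open>Gaussians on the line and their products\<close>

lemma nn_integral_gauss_real:
  assumes "k > 0"
  shows "(\<integral>\<^sup>+s. ennreal (exp (- pi * (k * s\<^sup>2))) \<partial>lborel) = ennreal (1 / sqrt k)"
proof -
  \<comment> \<open>With this variance the integrand is \<open>1 / sqrt k\<close> times a normal
    density, whose mass is 1.\<close>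
  define \<sigma> where "\<sigma> = sqrt (1 / (2 * pi * k))"
  have s: "\<sigma>\<^sup>2 = 1 / (2 * pi * k)" using assms by (simp add: \<sigma>_def)
  then have "\<sigma> > 0" using assms by (simp add: \<sigma>_def)
  have e: "exp (- pi * (k * x\<^sup>2)) = (1 / sqrt k) * normal_density 0 \<sigma> x" for x
    using assms unfolding normal_density_def s
    by (simp add: real_sqrt_divide field_simps)
  have "(\<integral>\<^sup>+s. ennreal (exp (- pi * (k * s\<^sup>2))) \<partial>lborel)
      = ennreal (\<integral>s. (1 / sqrt k) * normal_density 0 \<sigma> s \<partial>lborel)"
    unfolding e using assms \<open>\<sigma> > 0\<close>
    by (intro nn_integral_eq_integral) (auto simp: normal_density_nonneg)
  then show ?thesis using \<open>\<sigma> > 0\<close> by simp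
qed

text \<open>Variances add under convolution. The kernel has variance 1/(2 pi) and the target 1/(2 pi
  k), which is no smaller because k is at most 1; so \<rho> is a centred normal law carrying the
  difference \<open>\<tau>\<^sup>2\<close>, with total mass \<open>1 / sqrt k\<close>. For k = 1 the
  difference is 0 and the law degenerates to the point mass at 0.\<close>

lemma gauss_convolution_real:
  fixes k :: real
  assumes "0 < k" "k \<le> 1"
  shows "\<exists>\<rho>. finite_measure \<rho> \<and> sets \<rho> = sets (borel :: real measure) \<and>
     (\<forall>x. (\<integral>s. exp (- pi * (x - s)\<^sup>2) \<partial>\<rho>) = exp (- pi * (k * x\<^sup>2)))"
proof (cases "k = 1")
  case True
  have "finite_measure (return (borel :: real measure) 0)"
    by (rule prob_space.finite_measure) (simp add: prob_space_return)
  with True show ?thesis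
    by (intro exI[of _ "return borel 0"]) (auto simp: integral_return)
next
  case False
  with assms have k: "0 < k" "k < 1" by auto
  define \<sigma> where "\<sigma> = sqrt (1 / (2 * pi))"
  define \<tau> where "\<tau> = sqrt ((1 / k - 1) / (2 * pi))"
  define g where "g s = (1 / sqrt k) * normal_density 0 \<tau> s" for s
  define \<rho> where "\<rho> = density lborel g"
  have s: "\<sigma> > 0" "\<sigma>\<^sup>2 = 1 / (2 * pi)" by (auto simp: \<sigma>_def)
  have t: "\<tau> > 0" "\<tau>\<^sup>2 = (1 / k - 1) / (2 * pi)" using k by (auto simp: \<tau>_def)
  have st: "\<sigma>\<^sup>2 + \<tau>\<^sup>2 = 1 / (2 * pi * k)" unfolding s t using k by (simp add: field_simps)
  have g[measurable]: "g \<in> borel_measurable borel" and g0: "\<And>s. g s \<ge> 0" 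
    using k by (auto simp: g_def[abs_def] normal_density_nonneg)
  have gi: "integrable lborel g" unfolding g_def[abs_def] using t by auto
  have "finite_measure \<rho>"
    using integrableD(2)[OF gi] g0
    by (intro finite_measureI) (simp add: \<rho>_def emeasure_density)
  moreover have "sets \<rho> = sets (borel :: real measure)" by (simp add: \<rho>_def)
  moreover have "(\<integral>s. exp (- pi * (x - s)\<^sup>2) \<partial>\<rho>) = exp (- pi * (k * x\<^sup>2))" for x
  proof -
    have e: "exp (- (pi * y\<^sup>2)) = normal_density 0 \<sigma> y" for y
      unfolding normal_density_def s(2) by simp
    have "(\<integral>s. exp (- pi * (x - s)\<^sup>2) \<partial>\<rho>) = (\<integral>s. g s * exp (- pi * (x - s)\<^sup>2) \<partial>lborel)"
      unfolding \<rho>_def using g0 by (subst integral_density) auto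
    also have "\<dots> = enn2real (\<integral>\<^sup>+s. ennreal (g s * exp (- pi * (x - s)\<^sup>2)) \<partial>lborel)"
      using g0 by (intro integral_eq_nn_integral) auto
    also have "(\<integral>\<^sup>+s. ennreal (g s * exp (- pi * (x - s)\<^sup>2)) \<partial>lborel)
       = (\<integral>\<^sup>+s. ennreal (1 / sqrt k) * ennreal (normal_density 0 \<sigma> (x - s) * normal_density 0 \<tau> s) \<partial>lborel)"
      using k by (intro nn_integral_cong) (simp add: e g_def ennreal_mult[symmetric] normal_density_nonneg mult_ac)
    also have "\<dots> = ennreal (1 / sqrt k) * ennreal (normal_density 0 (sqrt (\<sigma>\<^sup>2 + \<tau>\<^sup>2)) x)"
      using fun_cong[OF conv_normal_density_zero_mean[OF s(1) t(1)], of x]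
      by (subst nn_integral_cmult) auto
    also have "enn2real \<dots> = (1 / sqrt k) * normal_density 0 (sqrt (\<sigma>\<^sup>2 + \<tau>\<^sup>2)) x"
      using k by (simp add: enn2real_mult normal_density_nonneg)
    also have "\<dots> = exp (- pi * (k * x\<^sup>2))"
      using k unfolding normal_density_def st
      by (simp add: real_sqrt_divide field_simps)
    finally show ?thesis .
  qed
  ultimately show ?thesis by blast
qed

lemma measurable_onb_sum[measurable]:
  fixes M :: "'a::euclidean_space \<Rightarrow> real measure"
  assumes "\<And>b. sets (M b) = sets borel"
  shows "(\<lambda>c. \<Sum>b\<in>B. c b *\<^sub>R b) \<in> borel_measurable (\<Pi>\<^sub>M b\<in>B. M b)"
proof -
  have "(\<lambda>c. c b) \<in> borel_measurable (\<Pi>\<^sub>M b\<in>B. M b)" if "b \<in> B" for b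
    using measurable_component_singleton[OF that, of M] assms by (simp cong: measurable_cong_sets)
  then show ?thesis by (intro borel_measurable_sum borel_measurable_scaleR) auto
qed

text \<open>In the coordinates of \<open>B\<close> the kernel is a product of one-dimensional
  kernels, so the image of a product of one-dimensional convolving measures does the job, with one
  weight \<open>k b\<close> per direction.\<close>

lemma of_type_id_gauss:
  fixes E :: "'a::euclidean_space set"
  assumes B: "orthonormal_basis_of E B" and k: "\<And>b. b \<in> B \<Longrightarrow> 0 < k b \<and> k b \<le> 1"
  shows "of_type E id (\<lambda>x. exp (- pi * (\<Sum>b\<in>B. k b * (x \<bullet> b)\<^sup>2)))"
proof -
  note [simp] = onb_finite[OF B]
  \<comment> \<open>The locale for product measures asks for a measure at every index, also outside
    \<open>B\<close>, where \<open>k\<close> is unconstrained; there the measure for the weight 1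
    serves as a filler.\<close>
  have "\<exists>\<rho>. \<forall>b. finite_measure (\<rho> b) \<and> sets (\<rho> b) = sets (borel :: real measure) \<and>
     (b \<in> B \<longrightarrow> (\<forall>x. (\<integral>s. exp (- pi * (x - s)\<^sup>2) \<partial>\<rho> b) = exp (- pi * (k b * x\<^sup>2))))"
  proof (rule choice, rule allI)
    fix b
    show "\<exists>\<rho>. finite_measure \<rho> \<and> sets \<rho> = sets (borel :: real measure) \<and>
     (b \<in> B \<longrightarrow> (\<forall>x. (\<integral>s. exp (- pi * (x - s)\<^sup>2) \<partial>\<rho>) = exp (- pi * (k b * x\<^sup>2))))"
      using gauss_convolution_real[of "k b"] gauss_convolution_real[of 1] k[of b]
      by (cases "b \<in> B") (blast, auto)
  qed
  then obtain \<rho> where fin: "\<And>b. finite_measure (\<rho> b)"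
    and [simp, measurable_cong]: "\<And>b. sets (\<rho> b) = sets (borel :: real measure)"
    and conv: "\<And>b x. b \<in> B \<Longrightarrow> (\<integral>s. exp (- pi * (x - s)\<^sup>2) \<partial>\<rho> b) = exp (- pi * (k b * x\<^sup>2))"
    by blast
  interpret product_sigma_finite \<rho>
    unfolding product_sigma_finite_def using fin by (blast intro: finite_measure.axioms(1))
  let ?X = "\<lambda>c. \<Sum>b\<in>B. c b *\<^sub>R b"
  let ?P = "\<Pi>\<^sub>M b\<in>B. \<rho> b"
  have Xm: "?X \<in> borel_measurable ?P"
    by (rule measurable_onb_sum) simp
  then have XmE: "?X \<in> measurable ?P (restrict_space borel E)"
    using onb_sum_in[OF B] by (intro measurable_restrict_space2) auto
  define \<mu> where "\<mu> = distr ?P (restrict_space borel E) ?X"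
  have "finite_measure ?P"
  proof (rule finite_measureI)
    have "emeasure ?P (space ?P) = (\<Prod>b\<in>B. emeasure (\<rho> b) (space (\<rho> b)))"
      unfolding space_PiM by (intro emeasure_PiM sets.top) simp
    then show "emeasure ?P (space ?P) \<noteq> \<infinity>"
      using fin by (simp add: ennreal_prod_eq_top finite_measure.emeasure_eq_measure)
  qed
  then have "finite_measure \<mu>"
    unfolding \<mu>_def using XmE by (rule finite_measure.finite_measure_distr)
  moreover have "sets \<mu> = sets (restrict_space borel E)" by (simp add: \<mu>_def)
  moreover have "exp (- pi * (\<Sum>b\<in>B. k b * (x \<bullet> b)\<^sup>2)) = (\<integral>y. gauss_normal E id (x - y) \<partial>\<mu>)"
    if x: "x \<in> E" for x
  proof -
    have "(\<integral>y. gauss_normal E id (x - y) \<partial>\<mu>) = (\<integral>c. gauss_normal E id (x - ?X c) \<partial>?P)"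
      unfolding \<mu>_def gauss_normal_id[OF onb_subspace[OF B]] using XmE
      by (intro integral_distr) (auto intro!: measurable_restrict_space1)
    also have "\<dots> = (\<integral>c. (\<Prod>b\<in>B. exp (- pi * (x \<bullet> b - c b)\<^sup>2)) \<partial>?P)"
    proof (rule Bochner_Integration.integral_cong[OF refl])
      fix c
      have "x - ?X c \<in> E" using x onb_sum_in[OF B] onb_subspace[OF B] by (auto intro: subspace_diff)
      then show "gauss_normal E id (x - ?X c) = (\<Prod>b\<in>B. exp (- pi * (x \<bullet> b - c b)\<^sup>2))"
        unfolding gauss_normal_id[OF onb_subspace[OF B]]
        by (simp add: onb_norm[OF B] inner_diff_left onb_sum_inner[OF B] sum_distrib_left
            sum_negf exp_sum[symmetric])
    qed
    also have "\<dots> = (\<Prod>b\<in>B. \<integral>s. exp (- pi * (x \<bullet> b - s)\<^sup>2) \<partial>\<rho> b)"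
    proof (rule product_integral_prod)
      fix b
      interpret finite_measure "\<rho> b" by (rule fin)
      show "integrable (\<rho> b) (\<lambda>s. exp (- pi * (x \<bullet> b - s)\<^sup>2))"
        by (rule integrable_const_bound[where B = 1]) auto
    qed simp
    also have "\<dots> = (\<Prod>b\<in>B. exp (- pi * (k b * (x \<bullet> b)\<^sup>2)))"
      by (intro prod.cong refl) (rule conv)
    also have "\<dots> = exp (- pi * (\<Sum>b\<in>B. k b * (x \<bullet> b)\<^sup>2))"
      by (simp add: sum_distrib_left sum_negf exp_sum[symmetric])
    finally show ?thesis by simp
  qed
  ultimately show ?thesis unfolding of_type_def by blast
qed

section \<open>Independence of the integral from the orthonormal basis\<close>

lemma nn_integral_coordinates_translate:
  fixes A :: "'a::euclidean_space set" and f :: "'a \<Rightarrow> ennreal"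
  assumes "finite A" and f: "f \<in> borel_measurable borel" and "v \<in> span A"
  shows "(\<integral>\<^sup>+c. f ((\<Sum>a\<in>A. c a *\<^sub>R a) + v) \<partial>(\<Pi>\<^sub>M a\<in>A. lborel))
       = (\<integral>\<^sup>+c. f (\<Sum>a\<in>A. c a *\<^sub>R a) \<partial>(\<Pi>\<^sub>M a\<in>A. lborel))"
  using assms
proof (induction A arbitrary: f v rule: finite_induct)
  case empty
  then show ?case by simp
next
  case (insert a A)
  interpret product_sigma_finite "\<lambda>a::'a. lborel :: real measure" ..
  note [measurable] = insert.prems(1)
  have [measurable]: "(\<lambda>c. \<Sum>b\<in>D. c b *\<^sub>R b) \<in> borel_measurable (\<Pi>\<^sub>M b\<in>D. lborel)" for D :: "'a set"
    by (rule measurable_onb_sum) simp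
  \<comment> \<open>The translation splits into a part in \<open>span A\<close>, removed by the
    induction hypothesis, and a multiple of \<open>a\<close>, removed by translation invariance on
    the line.\<close>
  from insert.prems obtain k where v: "v - k *\<^sub>R a \<in> span A"
    by (auto simp: span_insert)
  have upd: "(\<Sum>b\<in>A. (if b = a then s else c b) *\<^sub>R b) = (\<Sum>b\<in>A. c b *\<^sub>R b)" for c s
    using insert.hyps by (intro sum.cong) auto
  have "(\<integral>\<^sup>+c. f ((\<Sum>a\<in>insert a A. c a *\<^sub>R a) + v) \<partial>(\<Pi>\<^sub>M a\<in>insert a A. lborel))
     = (\<integral>\<^sup>+s. \<integral>\<^sup>+c. f (((\<Sum>b\<in>A. c b *\<^sub>R b) + (v - k *\<^sub>R a)) + (k + s) *\<^sub>R a) \<partial>(\<Pi>\<^sub>M a\<in>A. lborel) \<partial>lborel)"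
    using insert.hyps
    by (subst product_nn_integral_insert_rev) (auto simp: upd fun_upd_def scaleR_add_left algebra_simps)
  also have "\<dots> = (\<integral>\<^sup>+s. \<integral>\<^sup>+c. f ((\<Sum>b\<in>A. c b *\<^sub>R b) + (k + s) *\<^sub>R a) \<partial>(\<Pi>\<^sub>M a\<in>A. lborel) \<partial>lborel)"
    \<comment> \<open>The outer coordinate is fixed here, so the hypothesis is applied to a
      translate of \<open>f\<close>; this is why \<open>f\<close> is generalised in the
      induction.\<close>
    by (intro nn_integral_cong insert.IH[where f = "\<lambda>x. f (x + (k + _) *\<^sub>R a)"] v) measurable
  also have "\<dots> = (\<integral>\<^sup>+s. \<integral>\<^sup>+c. f ((\<Sum>b\<in>A. c b *\<^sub>R b) + s *\<^sub>R a) \<partial>(\<Pi>\<^sub>M a\<in>A. lborel) \<partial>lborel)"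
  proof -
    interpret A: sigma_finite_measure "\<Pi>\<^sub>M a\<in>A. lborel :: real measure"
      by (rule sigma_finite) fact
    show ?thesis
      \<comment> \<open>The substitution of \<open>k + s\<close> for \<open>s\<close> is made on the
        right-hand side.\<close>
      by (subst (2) nn_integral_real_affine[where c = 1 and t = k]) auto
  qed
  also have "\<dots> = (\<integral>\<^sup>+c. f (\<Sum>a\<in>insert a A. c a *\<^sub>R a) \<partial>(\<Pi>\<^sub>M a\<in>insert a A. lborel))"
    using insert.hyps
    by (subst product_nn_integral_insert_rev) (auto simp: upd fun_upd_def algebra_simps)
  finally show ?case .
qed

lemma nn_integral_coordinates_gauss:
  fixes E :: "'a::euclidean_space set"
  assumes B: "orthonormal_basis_of E B" and k: "\<And>b. b \<in> B \<Longrightarrow> 0 < k b"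
  shows "(\<integral>\<^sup>+c. ennreal (exp (- pi * (\<Sum>b\<in>B. k b * ((\<Sum>a\<in>B. c a *\<^sub>R a) \<bullet> b)\<^sup>2))) \<partial>(\<Pi>\<^sub>M a\<in>B. lborel))
       = ennreal (\<Prod>b\<in>B. 1 / sqrt (k b))"
proof -
  interpret product_sigma_finite "\<lambda>a::'a. lborel :: real measure" ..
  have "(\<integral>\<^sup>+c. ennreal (exp (- pi * (\<Sum>b\<in>B. k b * ((\<Sum>a\<in>B. c a *\<^sub>R a) \<bullet> b)\<^sup>2))) \<partial>(\<Pi>\<^sub>M a\<in>B. lborel))
     = (\<integral>\<^sup>+c. (\<Prod>b\<in>B. ennreal (exp (- pi * (k b * (c b)\<^sup>2)))) \<partial>(\<Pi>\<^sub>M a\<in>B. lborel))"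
    by (intro nn_integral_cong)
      (simp add: onb_sum_inner[OF B] sum_distrib_left sum_negf exp_sum[symmetric] onb_finite[OF B] prod_ennreal)
  also have "\<dots> = (\<Prod>b\<in>B. \<integral>\<^sup>+s. ennreal (exp (- pi * (k b * s\<^sup>2))) \<partial>lborel)"
    by (rule product_nn_integral_prod) (auto simp: onb_finite[OF B])
  also have "\<dots> = ennreal (\<Prod>b\<in>B. 1 / sqrt (k b))"
    using k by (subst prod_ennreal[symmetric]) (auto intro!: prod.cong simp: nn_integral_gauss_real[simplified] less_imp_le)
  finally show ?thesis .
qed

lemma nn_integral_coordinates_norm_gauss:
  fixes E :: "'a::euclidean_space set"
  assumes B: "orthonormal_basis_of E B"
  shows "(\<integral>\<^sup>+c. ennreal (exp (- pi * (norm (\<Sum>a\<in>B. c a *\<^sub>R a))\<^sup>2)) \<partial>(\<Pi>\<^sub>M a\<in>B. lborel)) = 1"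
  using nn_integral_coordinates_gauss[OF B, of "\<lambda>_. 1"]
  by (simp add: onb_norm[OF B onb_sum_in[OF B]])

text \<open>
  Uniqueness of Haar measure, by evaluating $\int\int f(x)\,g(x+y)\,dx\,dy$ in two ways, where $g$ is
  the standard Gaussian and $x$, $y$ are integrated in the coordinates of the two bases.
\<close>

lemma nn_integral_coordinates_basis_indep:
  fixes E :: "'a::euclidean_space set" and f :: "'a \<Rightarrow> ennreal"
  assumes A: "orthonormal_basis_of E A" and B: "orthonormal_basis_of E B"
    and f[measurable]: "f \<in> borel_measurable borel" and even: "\<And>x. f (- x) = f x"
  shows "(\<integral>\<^sup>+c. f (\<Sum>a\<in>A. c a *\<^sub>R a) \<partial>(\<Pi>\<^sub>M a\<in>A. lborel))
       = (\<integral>\<^sup>+c. f (\<Sum>b\<in>B. c b *\<^sub>R b) \<partial>(\<Pi>\<^sub>M b\<in>B. lborel))"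
proof -
  interpret product_sigma_finite "\<lambda>a::'a. lborel :: real measure" ..
  let ?A = "\<Pi>\<^sub>M a\<in>A. lborel :: real measure" and ?B = "\<Pi>\<^sub>M a\<in>B. lborel :: real measure"
  define XA where "XA c = (\<Sum>a\<in>A. c a *\<^sub>R a)" for c
  define XB where "XB c = (\<Sum>a\<in>B. c a *\<^sub>R a)" for c
  define g :: "'a \<Rightarrow> ennreal" where "g x = ennreal (exp (- pi * (norm x)\<^sup>2))" for x
  have g[measurable]: "g \<in> borel_measurable borel" by (simp add: g_def[abs_def])
  have [measurable]: "XA \<in> borel_measurable ?A" "XB \<in> borel_measurable ?B"
    unfolding XA_def[abs_def] XB_def[abs_def] by (auto intro: measurable_onb_sum)
  interpret pair_sigma_finite ?A ?B
    unfolding pair_sigma_finite_def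
    using sigma_finite[OF onb_finite[OF A]] sigma_finite[OF onb_finite[OF B]] by blast
  have span: "XA c \<in> span A" "XA c \<in> span B" "XB c \<in> span A" "XB c \<in> span B" for c
    using A B onb_sum_in[OF A, of c] onb_sum_in[OF B, of c]
    by (auto simp: orthonormal_basis_of_def XA_def XB_def)
  have shiftA: "(\<integral>\<^sup>+c. h (XA c + v) \<partial>?A) = (\<integral>\<^sup>+c. h (XA c) \<partial>?A)"
    if "h \<in> borel_measurable borel" "v \<in> span A" for h v
    using nn_integral_coordinates_translate[OF onb_finite[OF A] that] by (simp add: XA_def)
  have shiftB: "(\<integral>\<^sup>+c. h (XB c + v) \<partial>?B) = (\<integral>\<^sup>+c. h (XB c) \<partial>?B)"
    if "h \<in> borel_measurable borel" "v \<in> span B" for h v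
    using nn_integral_coordinates_translate[OF onb_finite[OF B] that] by (simp add: XB_def)
  have gA: "(\<integral>\<^sup>+c. g (XA c) \<partial>?A) = 1" and gB: "(\<integral>\<^sup>+c. g (XB c) \<partial>?B) = 1"
    using nn_integral_coordinates_norm_gauss[OF A] nn_integral_coordinates_norm_gauss[OF B]
    by (simp_all add: g_def XA_def XB_def)
  \<comment> \<open>The inserted factor is 1: both bases span the same space, so \<open>XA c\<close>
    is an admissible translation in the coordinates of \<open>B\<close>.\<close>
  have "(\<integral>\<^sup>+c. f (XA c) \<partial>?A) = (\<integral>\<^sup>+c. f (XA c) * (\<integral>\<^sup>+d. g (XB d + XA c) \<partial>?B) \<partial>?A)"
    using shiftB[OF g span(2)] by (simp add: gB)
  also have "\<dots> = (\<integral>\<^sup>+c. \<integral>\<^sup>+d. f (XA c) * g (XB d + XA c) \<partial>?B \<partial>?A)"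
    by (intro nn_integral_cong nn_integral_cmult[symmetric]) measurable
  also have "\<dots> = (\<integral>\<^sup>+d. \<integral>\<^sup>+c. f (XA c) * g (XB d + XA c) \<partial>?A \<partial>?B)"
    by (intro Fubini'[symmetric]) measurable
  also have "\<dots> = (\<integral>\<^sup>+d. \<integral>\<^sup>+c. f (XA c - XB d) * g (XA c) \<partial>?A \<partial>?B)"
  proof (rule nn_integral_cong)
    fix d
    show "(\<integral>\<^sup>+c. f (XA c) * g (XB d + XA c) \<partial>?A) = (\<integral>\<^sup>+c. f (XA c - XB d) * g (XA c) \<partial>?A)"
      using shiftA[of "\<lambda>x. f (x - XB d) * g x" "XB d"] span(3) by (simp add: add.commute)
  qed
  also have "\<dots> = (\<integral>\<^sup>+c. \<integral>\<^sup>+d. f (XA c - XB d) * g (XA c) \<partial>?B \<partial>?A)"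
    by (intro Fubini') measurable
  also have "\<dots> = (\<integral>\<^sup>+c. (\<integral>\<^sup>+d. f (XB d + - XA c) \<partial>?B) * g (XA c) \<partial>?A)"
    using even[of "XB _ - XA _"]
    by (intro nn_integral_cong, subst nn_integral_multc) auto
  also have "\<dots> = (\<integral>\<^sup>+c. (\<integral>\<^sup>+d. f (XB d) \<partial>?B) * g (XA c) \<partial>?A)"
    using shiftB[OF f span_neg[OF span(2)]] by simp
  also have "\<dots> = (\<integral>\<^sup>+d. f (XB d) \<partial>?B)"
    by (subst nn_integral_cmult) (auto simp: gA)
  finally show ?thesis by (simp add: XA_def XB_def)
qed

lemma space_lebesgue_sub: "space (lebesgue_sub E) = E"
  by (simp add: lebesgue_sub_def space_restrict_space)

text \<open>The exponent is diagonal in \<open>B\<close>, the measure is defined through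
  \<open>onb E\<close>. The integrand is even, so the integral may be computed in the coordinates of
  \<open>B\<close>, where it factors.\<close>

lemma nn_integral_lebesgue_sub_gauss:
  fixes E :: "'a::euclidean_space set"
  assumes B: "orthonormal_basis_of E B" and k: "\<And>b. b \<in> B \<Longrightarrow> 0 < k b"
  shows "(\<integral>\<^sup>+x. ennreal (exp (- pi * (\<Sum>b\<in>B. k b * (x \<bullet> b)\<^sup>2))) \<partial>lebesgue_sub E)
       = ennreal (\<Prod>b\<in>B. 1 / sqrt (k b))"
proof -
  note O = orthonormal_basis_of_onb[OF onb_subspace[OF B]]
  define f where "f x = ennreal (exp (- pi * (\<Sum>b\<in>B. k b * (x \<bullet> b)\<^sup>2)))" for x
  have f[measurable]: "f \<in> borel_measurable borel" by (simp add: f_def[abs_def])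
  have "(\<integral>\<^sup>+x. f x \<partial>lebesgue_sub E)
      = (\<integral>\<^sup>+c. f (\<Sum>a\<in>onb E. c a *\<^sub>R a) \<partial>(\<Pi>\<^sub>M a\<in>onb E. lborel))"
    unfolding lebesgue_sub_def
    by (intro nn_integral_distr measurable_restrict_space2)
      (auto intro: onb_sum_in[OF O] measurable_onb_sum measurable_restrict_space1[OF f])
  also have "\<dots> = (\<integral>\<^sup>+c. f (\<Sum>a\<in>B. c a *\<^sub>R a) \<partial>(\<Pi>\<^sub>M a\<in>B. lborel))"
    by (rule nn_integral_coordinates_basis_indep[OF O B f]) (simp add: f_def)
  also have "\<dots> = ennreal (\<Prod>b\<in>B. 1 / sqrt (k b))"
    unfolding f_def by (rule nn_integral_coordinates_gauss[OF B k])
  finally show ?thesis by (simp add: f_def)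
qed

subsection \<open>Singular values and adapted Gaussians\<close>

text \<open>The datum controls \<open>l\<close> only on \<open>H\<close>. Composing with the
  orthogonal projection onto \<open>H\<close> yields a map that is linear on the whole type, to
  which the theory of \<open>linear\<close> applies.\<close>

lemma linear_sub_extends:
  assumes H: "subspace H" and l: "linear_sub H F l"
  obtains g where "linear g" "\<And>x. x \<in> H \<Longrightarrow> g x = l x"
proof
  note O = orthonormal_basis_of_onb[OF H]
  let ?g = "\<lambda>x. \<Sum>b\<in>onb H. (x \<bullet> b) *\<^sub>R l b"
  show "linear ?g"
    by (intro linearI)
      (simp_all add: inner_add_left scaleR_add_left sum.distrib scaleR_sum_right)
  have l0: "l 0 = 0" using l subspace_0[OF H] unfolding linear_sub_def by (metis scaleR_zero_left)
  have sum: "(\<Sum>b\<in>S. c b *\<^sub>R b) \<in> H \<and> l (\<Sum>b\<in>S. c b *\<^sub>R b) = (\<Sum>b\<in>S. c b *\<^sub>R l b)"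
    if "finite S" "S \<subseteq> H" for S c
    using that
  proof (induction S rule: finite_induct)
    case empty
    then show ?case by (simp add: l0 subspace_0[OF H])
  next
    case (insert b S)
    then have "c b *\<^sub>R b \<in> H" "(\<Sum>b\<in>S. c b *\<^sub>R b) \<in> H"
      using H by (auto intro: subspace_scale)
    with insert l H show ?case by (auto simp: linear_sub_def subspace_add)
  qed
  show "?g x = l x" if "x \<in> H" for x
    using sum[OF onb_finite[OF O] onb_subset[OF O], of "\<lambda>b. x \<bullet> b"] onb_expand[OF O that] by simp
qed

lemma bdd_above_onorm_sub:
  fixes g :: "'a::euclidean_space \<Rightarrow> 'b::euclidean_space"
  assumes "linear g" "\<And>x. x \<in> H \<Longrightarrow> g x = l x"
  shows "bdd_above ((\<lambda>x. norm (l x) / norm x) ` H)"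
proof (rule bdd_aboveI2)
  show "norm (l x) / norm x \<le> onorm g" if "x \<in> H" for x
    using le_onorm[of g x] assms(1) assms(2)[OF that] by (simp add: linear_conv_bounded_linear)
qed

lemma onorm_sub_bound:
  assumes "linear g" "\<And>x. x \<in> H \<Longrightarrow> g x = l x" "x \<in> H"
  shows "norm (l x) \<le> onorm_sub H l * norm x"
proof (cases "x = 0")
  case True
  then show ?thesis using assms(1) assms(2)[OF assms(3)] by (simp add: linear_0)
next
  case False
  have "norm (l x) / norm x \<le> onorm_sub H l"
    unfolding onorm_sub_def using bdd_above_onorm_sub[OF assms(1,2)] assms(3)
    by (intro cSUP_upper) auto
  then show ?thesis using False by (simp add: divide_le_eq)
qed

lemma onorm_sub_nonneg:
  assumes H: "subspace H" and l: "linear_sub H F l"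
  shows "0 \<le> onorm_sub H l"
proof -
  obtain g where "linear g" "\<And>x. x \<in> H \<Longrightarrow> g x = l x"
    by (rule linear_sub_extends[OF H l], rule that) blast+
  \<comment> \<open>The point 0 always lies in \<open>H\<close>, and its quotient is 0 because
    division by 0 gives 0; this covers the zero space.\<close>
  from bdd_above_onorm_sub[OF this] show ?thesis
    unfolding onorm_sub_def using subspace_0[OF H] by (intro cSUP_upper2[of _ _ 0]) auto
qed

text \<open>As \<open>adjoint_sub\<close> is a choice, its properties rest on a witness: the vector
  of \<open>W\<close> whose coordinate along each \<open>b\<close> in \<open>onb W\<close> is
  \<open>g b \<bullet> y\<close>.\<close>

lemma adjoint_sub:
  assumes W: "subspace W" and g: "linear g" and y: "y \<in> F"
  shows "adjoint_sub W F g y \<in> W" "x \<in> W \<Longrightarrow> g x \<bullet> y = x \<bullet> adjoint_sub W F g y"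
proof -
  note O = orthonormal_basis_of_onb[OF W]
  have "g x \<bullet> y = x \<bullet> (\<Sum>b\<in>onb W. (g b \<bullet> y) *\<^sub>R b)" if "x \<in> W" for x y
  proof -
    have "g x \<bullet> y = g (\<Sum>b\<in>onb W. (x \<bullet> b) *\<^sub>R b) \<bullet> y" by (simp add: onb_expand[OF O that])
    also have "\<dots> = x \<bullet> (\<Sum>b\<in>onb W. (g b \<bullet> y) *\<^sub>R b)"
      using g by (simp add: linear_sum linear_scale inner_sum_left inner_sum_right mult.commute)
    finally show ?thesis .
  qed
  then have "\<exists>h. \<forall>y\<in>F. h y \<in> W \<and> (\<forall>x\<in>W. g x \<bullet> y = x \<bullet> h y)"
    by (intro exI[of _ "\<lambda>y. \<Sum>b\<in>onb W. (g b \<bullet> y) *\<^sub>R b"]) (auto intro: onb_sum_in[OF O])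
  then have "\<forall>y\<in>F. adjoint_sub W F g y \<in> W \<and> (\<forall>x\<in>W. g x \<bullet> y = x \<bullet> adjoint_sub W F g y)"
    unfolding adjoint_sub_def by (rule someI_ex)
  with y show "adjoint_sub W F g y \<in> W" "x \<in> W \<Longrightarrow> g x \<bullet> y = x \<bullet> adjoint_sub W F g y" by auto
qed

text \<open>Transfers the rank from \<open>l\<close> to its linear extension. The predicate behind
  the choice of the adjoint sees the map only on \<open>W\<close>, so both maps get the very same
  adjoint.\<close>

lemma essential_rank_cong:
  assumes "\<And>x. x \<in> W \<Longrightarrow> g x = l x"
  shows "essential_rank \<alpha> W F g = essential_rank \<alpha> W F l"
proof -
  have "adjoint_sub W F g = adjoint_sub W F l"
    unfolding adjoint_sub_def using assms by simp
  then have "singular_space W F g s = singular_space W F l s" for s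
    using assms by (auto simp: singular_space_def)
  then show ?thesis by (simp add: essential_rank_def singular_values_def)
qed

section \<open>Splitting off the large singular values\<close>

lemma dim_Union_le:
  fixes V :: "'i \<Rightarrow> 'a::euclidean_space set"
  assumes "finite S"
  shows "dim (\<Union>s\<in>S. V s) \<le> (\<Sum>s\<in>S. dim (V s))"
proof -
  have "\<exists>B. \<forall>s. finite (B s) \<and> card (B s) = dim (V s) \<and> V s \<subseteq> span (B s)"
    by (rule choice, rule allI) (metis basis_exists independent_imp_finite)
  then obtain B where B: "\<And>s. finite (B s)" "\<And>s. card (B s) = dim (V s)" "\<And>s. V s \<subseteq> span (B s)"
    by blast
  have "(\<Union>s\<in>S. V s) \<subseteq> span (\<Union>s\<in>S. B s)"
    using B(3) by (blast intro: span_mono[THEN subsetD, rotated])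
  then have "dim (\<Union>s\<in>S. V s) \<le> card (\<Union>s\<in>S. B s)"
    using assms B(1) by (intro dim_le_card) auto
  also have "\<dots> \<le> (\<Sum>s\<in>S. card (B s))" using assms by (rule card_UN_le)
  finally show ?thesis by (simp add: B(2))
qed

text \<open>The first-order condition at a minimum: a small step against the sign of
  \<open>p\<close> would make the quadratic negative.\<close>

lemma linear_coefficient_zero:
  fixes p r :: real
  assumes "\<And>e. 0 \<le> 2 * e * p + e\<^sup>2 * r"
  shows "p = 0"
proof (rule ccontr)
  assume "p \<noteq> 0"
  have r: "r \<ge> 0" using assms[of 1] assms[of "-1"] by simp
  \<comment> \<open>The minimiser would be \<open>- p / r\<close>; adding 1 avoids a zero
    denominator.\<close>
  define e where "e = - p / (r + 1)"
  have p: "p = - (e * (r + 1))" and "e \<noteq> 0" using r \<open>p \<noteq> 0\<close> by (auto simp: e_def)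
  have "2 * e * p + e\<^sup>2 * r = - (e\<^sup>2 * (r + 2))"
    unfolding p by (simp add: algebra_simps power2_eq_square)
  also have "\<dots> < 0" using r \<open>e \<noteq> 0\<close> by simp
  finally show False using assms[of e] by simp
qed

text \<open>
  The subspace is the sum of the singular spaces for the values above \<open>\<alpha>\<close>. That nothing larger
  remains on its complement is seen from a maximiser of the Rayleigh quotient there, which is a
  singular vector.
\<close>

lemma large_singular_subspace:
  fixes g :: "'a::euclidean_space \<Rightarrow> 'b::euclidean_space"
  assumes W: "subspace W" and g: "linear g" and gW: "g ` W \<subseteq> F" and "\<alpha> \<ge> 0"
  obtains W1 where "subspace W1" "W1 \<subseteq> W" "dim W1 \<le> essential_rank \<alpha> W F g"
    "\<And>u v. u \<in> W1 \<Longrightarrow> v \<in> W \<Longrightarrow> \<forall>w\<in>W1. w \<bullet> v = 0 \<Longrightarrow> g u \<bullet> g v = 0"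
    "\<And>v. v \<in> W \<Longrightarrow> \<forall>w\<in>W1. w \<bullet> v = 0 \<Longrightarrow> norm (g v) \<le> \<alpha> * norm v"
proof -
  have gF: "g x \<in> F" if "x \<in> W" for x using gW that by blast
  define A where "A x = adjoint_sub W F g (g x)" for x
  have A_in: "A x \<in> W" if "x \<in> W" for x
    unfolding A_def using adjoint_sub(1)[OF W g gF[OF that]] .
  have A_inner: "g x \<bullet> g y = x \<bullet> A y" if "x \<in> W" "y \<in> W" for x y
    unfolding A_def using adjoint_sub(2)[OF W g gF[OF that(2)] that(1)] .
  define V where "V = singular_space W F g"
  have V: "x \<in> V s \<longleftrightarrow> x \<in> W \<and> A x = s\<^sup>2 *\<^sub>R x" for x s
    by (simp add: V_def singular_space_def A_def)
  define S where "S = {s. s \<in> singular_values W F g \<and> s > \<alpha>}"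
  have orth: "x \<bullet> y = 0" if "x \<in> V s" "y \<in> V t" "s \<noteq> t" "s \<ge> 0" "t \<ge> 0" for x y s t
  proof -
    have "x \<bullet> A y = y \<bullet> A x"
      using that A_inner[of x y] A_inner[of y x] by (simp add: V inner_commute)
    then have "(t\<^sup>2 - s\<^sup>2) * (x \<bullet> y) = 0" using that by (simp add: V inner_commute algebra_simps)
    moreover have "t\<^sup>2 \<noteq> s\<^sup>2" using that by simp
    ultimately show ?thesis by simp
  qed
  \<comment> \<open>A sum over an infinite set is 0 by convention, which would ruin the bound on
    \<open>dim W1\<close>. One nonzero singular vector per value gives an orthogonal, hence
    independent and finite, family.\<close>
  have "finite S"
  proof -
    have "\<exists>e. \<forall>s\<in>S. e s \<in> V s \<and> e s \<noteq> 0"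
      by (rule bchoice) (auto simp: S_def singular_values_def V_def)
    then obtain e where e: "\<And>s. s \<in> S \<Longrightarrow> e s \<in> V s \<and> e s \<noteq> 0" by blast
    have eo: "e s \<bullet> e t = 0" if "s \<in> S" "t \<in> S" "s \<noteq> t" for s t
      using orth[of "e s" s "e t" t] e that by (auto simp: S_def singular_values_def)
    have "pairwise orthogonal (e ` S)" using eo by (auto simp: pairwise_def orthogonal_def)
    moreover have "0 \<notin> e ` S" using e by force
    ultimately have "finite (e ` S)"
      using pairwise_orthogonal_independent independent_imp_finite by blast
    moreover have "inj_on e S" using eo e by (metis inj_onI inner_eq_zero_iff)
    ultimately show ?thesis by (rule finite_imageD)
  qed
  define W1 where "W1 = span (\<Union>s\<in>S. V s)"
  have "subspace W1" by (simp add: W1_def)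
  have "(\<Union>s\<in>S. V s) \<subseteq> W" by (auto simp: V)
  then have "W1 \<subseteq> W" unfolding W1_def using W by (rule span_minimal)
  have "dim W1 \<le> essential_rank \<alpha> W F g"
    using dim_Union_le[OF \<open>finite S\<close>, of V] by (simp add: W1_def essential_rank_def V_def S_def)
  have gorth: "g u \<bullet> g v = 0" if u: "u \<in> W1" and v: "v \<in> W" "\<And>w. w \<in> W1 \<Longrightarrow> w \<bullet> v = 0" for u v
    using u unfolding W1_def
  proof (induction rule: span_induct)
    case base
    show ?case
      using g by (auto simp: subspace_def linear_0 linear_add linear_scale inner_add_left)
  next
    case (step x)
    then obtain s where s: "s \<in> S" "x \<in> V s" by blast
    then have "x \<in> W1" unfolding W1_def by (blast intro: span_base)
    \<comment> \<open>Here \<open>A x\<close> is a multiple of \<open>x\<close>, so orthogonality to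
      \<open>W1\<close> survives the application of \<open>g\<close>.\<close>
    have "g x \<bullet> g v = v \<bullet> A x" using s v A_inner[of v x] by (simp add: V inner_commute)
    then show ?case using s v(2)[OF \<open>x \<in> W1\<close>] by (simp add: V inner_commute)
  qed
  define W2 where "W2 = {v \<in> W. \<forall>w\<in>W1. w \<bullet> v = 0}"
  have W2: "subspace W2"
    using W by (auto simp: W2_def subspace_def inner_add_right)
  have bound: "norm (g v) \<le> \<alpha> * norm v" if "v \<in> W" "\<And>w. w \<in> W1 \<Longrightarrow> w \<bullet> v = 0" for v
  proof (rule ccontr)
    assume less: "\<not> ?thesis"
    have "v \<in> W2" using that by (auto simp: W2_def)
    have "v \<noteq> 0" using less g by (auto simp: linear_0)
    let ?K = "W2 \<inter> sphere 0 1"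
    have "v /\<^sub>R norm v \<in> ?K" using \<open>v \<noteq> 0\<close> \<open>v \<in> W2\<close> W2 by (simp add: subspace_scale)
    moreover have "compact ?K"
      using closed_subspace[OF W2] by (simp add: closed_Int_compact)
    moreover have "continuous_on ?K (\<lambda>x. (norm (g x))\<^sup>2)"
      using g by (intro continuous_intros linear_continuous_on) (simp add: linear_conv_bounded_linear)
    ultimately obtain e where e: "e \<in> ?K" and "\<forall>x\<in>?K. (norm (g x))\<^sup>2 \<le> (norm (g e))\<^sup>2"
      using continuous_attains_sup[of ?K "\<lambda>x. (norm (g x))\<^sup>2"] by blast
    then have max: "(norm (g x))\<^sup>2 \<le> (norm (g e))\<^sup>2" if "x \<in> ?K" for x using that by blast
    define m where "m = (norm (g e))\<^sup>2"
    have quad: "(norm (g x))\<^sup>2 \<le> m * (norm x)\<^sup>2" if "x \<in> W2" for x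
    proof (cases "x = 0")
      case True
      then show ?thesis using g by (simp add: linear_0)
    next
      case False
      then have "x /\<^sub>R norm x \<in> ?K" using that W2 by (simp add: subspace_scale)
      from max[OF this] show ?thesis
        using False g by (simp add: m_def linear_scale power_mult_distrib field_simps)
    qed
    have "e \<in> W2" "e \<in> W" "norm e = 1" using e by (auto simp: W2_def)
    have "(\<alpha> * norm v)\<^sup>2 < (norm (g v))\<^sup>2"
      using less \<open>\<alpha> \<ge> 0\<close> by (intro power_strict_mono) auto
    also have "\<dots> \<le> m * (norm v)\<^sup>2" using quad[OF \<open>v \<in> W2\<close>] .
    finally have m: "\<alpha>\<^sup>2 < m" using \<open>v \<noteq> 0\<close> by (simp add: power_mult_distrib)
    define z where "z = m *\<^sub>R e - A e"
    \<comment> \<open>Invariance of \<open>W2\<close> makes the defect \<open>z\<close> an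
      admissible direction in which to vary the maximiser.\<close>
    have "A e \<in> W2"
      unfolding W2_def
    proof (intro CollectI conjI ballI)
      show "A e \<in> W" using A_in[OF \<open>e \<in> W\<close>] .
      fix w assume "w \<in> W1"
      then have "g w \<bullet> g e = 0" using \<open>e \<in> W2\<close> by (intro gorth) (auto simp: W2_def)
      then show "w \<bullet> A e = 0" using A_inner[of w e] \<open>w \<in> W1\<close> \<open>W1 \<subseteq> W\<close> \<open>e \<in> W\<close> by auto
    qed
    then have "z \<in> W2" unfolding z_def using W2 \<open>e \<in> W2\<close> by (simp add: subspace_diff subspace_scale)
    then have "z \<in> W" by (simp add: W2_def)
    \<comment> \<open>The form \<open>m * (norm x)\<^sup>2 - (norm (g x))\<^sup>2\<close> is
      nonnegative on \<open>W2\<close> and vanishes at \<open>e\<close>, so its derivative along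
      \<open>z\<close> is 0. By the choice of \<open>z\<close>, half that derivative is
      \<open>z \<bullet> z\<close>.\<close>
    have "m * (e \<bullet> z) - g e \<bullet> g z = 0"
    proof (rule linear_coefficient_zero)
      fix \<epsilon> :: real
      have "e + \<epsilon> *\<^sub>R z \<in> W2" using W2 \<open>z \<in> W2\<close> \<open>e \<in> W2\<close> by (simp add: subspace_add subspace_scale)
      from quad[OF this] have "0 \<le> m * (norm (e + \<epsilon> *\<^sub>R z))\<^sup>2 - (norm (g (e + \<epsilon> *\<^sub>R z)))\<^sup>2" by simp
      also have "\<dots> = (m * (norm e)\<^sup>2 - (norm (g e))\<^sup>2) + 2 * \<epsilon> * (m * (e \<bullet> z) - g e \<bullet> g z)
          + \<epsilon>\<^sup>2 * (m * (z \<bullet> z) - g z \<bullet> g z)"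
        using g unfolding power2_norm_eq_inner
        by (simp add: linear_add linear_scale inner_add_left inner_add_right
            inner_commute algebra_simps power2_eq_square)
      finally show "0 \<le> 2 * \<epsilon> * (m * (e \<bullet> z) - g e \<bullet> g z) + \<epsilon>\<^sup>2 * (m * (z \<bullet> z) - g z \<bullet> g z)"
        using \<open>norm e = 1\<close> by (simp add: m_def)
    qed
    moreover have "g e \<bullet> g z = z \<bullet> A e"
      using A_inner[OF \<open>z \<in> W\<close> \<open>e \<in> W\<close>] by (simp add: inner_commute)
    moreover have "z \<bullet> z = z \<bullet> (m *\<^sub>R e - A e)" by (simp add: z_def)
    then have "z \<bullet> z = m * (e \<bullet> z) - z \<bullet> A e"
      unfolding inner_diff_right by (simp add: inner_commute)
    ultimately have "z \<bullet> z = 0" by simp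
    then have "A e = m *\<^sub>R e" by (simp add: z_def)
    then have "e \<in> V (sqrt m)" using \<open>e \<in> W\<close> by (simp add: V m_def)
    moreover have "\<alpha> < sqrt m" using m \<open>\<alpha> \<ge> 0\<close> by (simp add: real_less_rsqrt)
    moreover have "0 \<le> m" by (simp add: m_def)
    ultimately have "sqrt m \<in> S"
      using \<open>norm e = 1\<close> unfolding S_def singular_values_def V_def
      by (auto intro!: bexI[of _ e])
    with \<open>e \<in> V (sqrt m)\<close> have "e \<in> W1" unfolding W1_def by (blast intro: span_base)
    with \<open>e \<in> W2\<close> have "e \<bullet> e = 0" by (simp add: W2_def)
    with \<open>norm e = 1\<close> show False by simp
  qed
  show thesis
    by (rule that[OF \<open>subspace W1\<close> \<open>W1 \<subseteq> W\<close> \<open>dim W1 \<le> _\<close>]) (simp_all add: gorth bound)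
qed

text \<open>
  The coefficients \<open>c\<close> and \<open>d\<close> write the left-hand side without its \<open>w2\<close> part as a convex
  combination of \<open>g (\<alpha> w1 + h)\<close> and of the reflection of \<open>g (\<alpha> w1 - h)\<close> in the range of \<open>P\<close>.
\<close>

lemma norm_weighted_image_le:
  fixes g :: "'a::euclidean_space \<Rightarrow> 'b::euclidean_space" and P :: "'b \<Rightarrow> 'b"
  assumes g: "linear g" and P: "linear P" and PQ: "\<And>y z. P y \<bullet> (z - P z) = 0"
    and orth: "w1 \<bullet> w2 = 0" "w1 \<bullet> h = 0" "w2 \<bullet> h = 0"
    and Pw: "P (g w1) = g w1" "P (g w2) = 0"
    and w2: "norm (g w2) \<le> \<alpha> * norm w2" and \<alpha>: "0 < \<alpha>" "\<alpha> \<le> 1" and "L \<ge> 0"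
    and Lp: "norm (g (\<alpha> *\<^sub>R w1 + h)) \<le> L * norm (\<alpha> *\<^sub>R w1 + h)"
    and Lm: "norm (g (\<alpha> *\<^sub>R w1 - h)) \<le> L * norm (\<alpha> *\<^sub>R w1 - h)"
  defines "y \<equiv> g (w1 + w2 + h)"
  shows "norm (\<alpha> *\<^sub>R P y + (y - P y)) \<le> (L + 1) * norm (\<alpha> *\<^sub>R (w1 + w2) + h)"
proof -
  define a where "a = \<alpha> *\<^sub>R w1"
  define ref where "ref = P (g (a - h)) + P (g (a - h)) - g (a - h)"
  have "(norm ref)\<^sup>2 = (norm (g (a - h)))\<^sup>2"
    using PQ[of "g (a - h)" "g (a - h)"] unfolding ref_def power2_norm_eq_inner
    by (simp add: inner_add_left inner_add_right inner_diff_left inner_diff_right inner_commute)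
  then have ref: "norm ref = norm (g (a - h))" by simp
  \<comment> \<open>In the combination below, \<open>g h\<close> gets the factor
    \<open>c - d = \<alpha>\<close> in the range of \<open>P\<close> and \<open>c + d = 1\<close>
    across it, while \<open>g a\<close>, lying in that range, gets \<open>c + d = 1\<close>.\<close>
  define c d where "c = (1 + \<alpha>) / 2" and "d = (1 - \<alpha>) / 2"
  have cd: "c = 1 - d" "\<alpha> = 1 - d - d" by (auto simp: c_def d_def field_simps)
  have eq: "\<alpha> *\<^sub>R P y + (y - P y) = c *\<^sub>R g (a + h) + d *\<^sub>R ref + g w2"
    unfolding ref_def a_def y_def cd using g P Pw
    by (simp add: linear_add linear_diff linear_scale algebra_simps)
      (simp add: scaleR_add_left[symmetric])
  \<comment> \<open>Since \<open>a\<close> and \<open>h\<close> are orthogonal, both terms of the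
    combination obey the same bound, and convexity costs nothing.\<close>
  have same: "norm (a - h) = norm (a + h)"
    using orth unfolding norm_eq_sqrt_inner a_def
    by (simp add: inner_add_left inner_add_right inner_diff_left inner_diff_right inner_commute)
  have sq: "(norm (\<alpha> *\<^sub>R (w1 + w2) + h))\<^sup>2 = (norm (a + h))\<^sup>2 + (\<alpha> * norm w2)\<^sup>2"
    using orth unfolding power_mult_distrib power2_norm_eq_inner a_def
    by (simp add: inner_add_left inner_add_right inner_commute algebra_simps power2_eq_square)
  have n1: "norm (a + h) \<le> norm (\<alpha> *\<^sub>R (w1 + w2) + h)"
    by (rule power2_le_imp_le) (auto simp: sq)
  have n2: "\<alpha> * norm w2 \<le> norm (\<alpha> *\<^sub>R (w1 + w2) + h)"
    by (rule power2_le_imp_le) (auto simp: sq)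
  have "norm (\<alpha> *\<^sub>R P y + (y - P y))
      \<le> c * norm (g (a + h)) + d * norm ref + norm (g w2)"
    unfolding eq using \<alpha>
    by (intro order_trans[OF norm_triangle_ineq] add_mono) (auto simp: c_def d_def)
  also have "\<dots> \<le> c * (L * norm (a + h)) + d * (L * norm (a + h)) + \<alpha> * norm w2"
    using Lp Lm \<alpha> w2 same unfolding ref
    by (intro add_mono mult_left_mono) (auto simp: a_def c_def d_def)
  also have "\<dots> = L * norm (a + h) + \<alpha> * norm w2"
    by (simp add: cd algebra_simps)
  \<comment> \<open>The part \<open>w2\<close> is the source of the added 1 in the constant.\<close>
  also have "\<dots> \<le> L * norm (\<alpha> *\<^sub>R (w1 + w2) + h) + norm (\<alpha> *\<^sub>R (w1 + w2) + h)"
    using n1 n2 \<open>L \<ge> 0\<close> by (intro add_mono mult_left_mono)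
  finally show ?thesis by (simp add: algebra_simps)
qed

text \<open>Joins orthonormal bases of \<open>E\<close> and of its complement in \<open>F\<close>,
  with weights \<open>\<alpha>\<^sup>2\<close> and 1; \<open>P\<close> is the orthogonal projection
  onto \<open>E\<close>. It serves both sides of the inequality: for the image of \<open>W1\<close>
  it produces D_j, for \<open>W\<close> in \<open>H\<close> it produces S.\<close>

lemma adapted_basis:
  fixes E F :: "'a::euclidean_space set"
  assumes F: "subspace F" and E: "subspace E" "E \<subseteq> F" and \<alpha>: "0 < \<alpha>" "\<alpha> \<le> 1"
  obtains B k P where "orthonormal_basis_of F B" "\<And>b. b \<in> B \<Longrightarrow> 0 < k b \<and> k b \<le> 1"
    "(\<Prod>b\<in>B. 1 / sqrt (k b)) = \<alpha> powr (- real (dim E))"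
    "linear P" "\<And>y z. P y \<bullet> (z - P z) = 0" "\<And>y. P y \<in> E" "\<And>y. y \<in> E \<Longrightarrow> P y = y"
    "\<And>y. \<forall>e\<in>E. e \<bullet> y = 0 \<Longrightarrow> P y = 0"
    "\<And>y. y \<in> F \<Longrightarrow> (\<Sum>b\<in>B. k b * (y \<bullet> b)\<^sup>2) = (norm (\<alpha> *\<^sub>R P y + (y - P y)))\<^sup>2"
proof -
  define G where "G = {y \<in> F. \<forall>e\<in>E. e \<bullet> y = 0}"
  have G: "subspace G" using F by (auto simp: G_def subspace_def inner_add_right)
  note OE = orthonormal_basis_of_onb[OF E(1)] and OG = orthonormal_basis_of_onb[OF G]
  define P where "P y = (\<Sum>b\<in>onb E. (y \<bullet> b) *\<^sub>R b)" for y
  define k where "k b = (if b \<in> onb E then \<alpha>\<^sup>2 else 1)" for b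
  have P: "linear P"
    unfolding P_def
    by (intro linearI) (simp_all add: inner_add_left scaleR_add_left sum.distrib scaleR_sum_right)
  have PE: "P y \<in> E" for y unfolding P_def by (rule onb_sum_in[OF OE])
  have Pid: "P y = y" if "y \<in> E" for y unfolding P_def by (rule onb_expand[OF OE that])
  have P0: "P y = 0" if "\<forall>e\<in>E. e \<bullet> y = 0" for y
    unfolding P_def using that onb_subset[OF OE] by (intro sum.neutral) (auto simp: inner_commute)
  have PQ: "e \<bullet> (z - P z) = 0" if "e \<in> E" for e z
  proof -
    have "b \<bullet> (z - P z) = 0" if "b \<in> onb E" for b
      using onb_sum_inner[OF OE that, of "\<lambda>b. z \<bullet> b"]
      by (simp add: P_def inner_diff_right inner_commute)
    then have "(\<Sum>b\<in>onb E. (e \<bullet> b) *\<^sub>R b) \<bullet> (z - P z) = 0"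
      by (simp add: inner_sum_left)
    then show ?thesis by (simp add: onb_expand[OF OE that])
  qed
  have QG: "z - P z \<in> G" if "z \<in> F" for z
    using subspace_diff[OF F that, of "P z"] PQ PE E(2) by (auto simp: G_def)
  have EG: "a \<bullet> b = 0" "b \<bullet> a = 0" if "a \<in> onb E" "b \<in> onb G" for a b
  proof -
    have "a \<in> E" "b \<in> G" using that onb_subset[OF OE] onb_subset[OF OG] by auto
    then show "a \<bullet> b = 0" "b \<bullet> a = 0" by (auto simp: G_def inner_commute)
  qed
  have disj: "onb E \<inter> onb G = {}"
    using EG onb_inner[OF OE] by (metis disjoint_iff zero_neq_one)
  let ?B = "onb E \<union> onb G"
  have B: "orthonormal_basis_of F ?B"
    unfolding orthonormal_basis_of_def
  proof (intro conjI)
    show "pairwise orthogonal ?B"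
      using EG OE OG by (auto simp: pairwise_def orthogonal_def orthonormal_basis_of_def)
    show "\<forall>b\<in>?B. norm b = 1" using OE OG by (auto simp: orthonormal_basis_of_def)
    show "finite ?B" using OE OG by (auto simp: orthonormal_basis_of_def)
    show "span ?B = F"
    proof
      show "span ?B \<subseteq> F"
        using onb_subset[OF OE] onb_subset[OF OG] E F by (intro span_minimal) (auto simp: G_def)
      show "F \<subseteq> span ?B"
      proof
        fix y assume "y \<in> F"
        have "P y \<in> span (onb E)" "y - P y \<in> span (onb G)"
          using PE QG[OF \<open>y \<in> F\<close>] OE OG by (auto simp: orthonormal_basis_of_def)
        then have "P y + (y - P y) \<in> span ?B"
          by (meson span_add span_mono subsetD sup_ge1 sup_ge2)
        then show "y \<in> span ?B" by simp
      qed
    qed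
  qed
  have kG: "k b = 1" if "b \<in> onb G" for b using that disj by (auto simp: k_def)
  have "(\<Prod>b\<in>?B. 1 / sqrt (k b)) = (\<Prod>b\<in>onb E. 1 / sqrt (k b)) * (\<Prod>b\<in>onb G. 1 / sqrt (k b))"
    using onb_finite[OF OE] onb_finite[OF OG] disj by (rule prod.union_disjoint)
  also have "(\<Prod>b\<in>onb G. 1 / sqrt (k b)) = 1" by (simp add: kG)
  also have "(\<Prod>b\<in>onb E. 1 / sqrt (k b)) * 1 = (1 / \<alpha>) ^ dim E"
    using \<alpha> by (simp add: onb_card[OF OE] k_def)
  also have "\<dots> = \<alpha> powr (- real (dim E))"
    using \<alpha> by (simp add: powr_minus powr_realpow divide_inverse power_inverse)
  finally have prod: "(\<Prod>b\<in>?B. 1 / sqrt (k b)) = \<alpha> powr (- real (dim E))" .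
  have quad: "(\<Sum>b\<in>?B. k b * (y \<bullet> b)\<^sup>2) = (norm (\<alpha> *\<^sub>R P y + (y - P y)))\<^sup>2" if "y \<in> F" for y
  proof -
    let ?z = "\<alpha> *\<^sub>R P y + (y - P y)"
    have "?z \<in> F" using PE[of y] QG[OF that] E F by (auto simp: G_def intro!: subspace_add subspace_scale)
    then have "(norm ?z)\<^sup>2 = (\<Sum>b\<in>?B. (?z \<bullet> b)\<^sup>2)" by (rule onb_norm[OF B])
    also have "\<dots> = (\<Sum>b\<in>?B. k b * (y \<bullet> b)\<^sup>2)"
    proof (rule sum.cong[OF refl])
      fix b assume "b \<in> ?B"
      then show "(?z \<bullet> b)\<^sup>2 = k b * (y \<bullet> b)\<^sup>2"
      proof
        assume b: "b \<in> onb E"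
        then have "P y \<bullet> b = y \<bullet> b" unfolding P_def by (rule onb_sum_inner[OF OE])
        then show ?thesis using b by (simp add: k_def inner_add_left inner_diff_left power_mult_distrib)
      next
        assume b: "b \<in> onb G"
        then have "P y \<bullet> b = 0" using PE[of y] onb_subset[OF OG] by (auto simp: G_def)
        then show ?thesis using b by (simp add: kG inner_add_left inner_diff_left)
      qed
    qed
    finally show ?thesis by simp
  qed
  have k: "0 < k b \<and> k b \<le> 1" for b using \<alpha> by (simp add: k_def power_le_one)
  show thesis by (rule that[OF B k prod P PQ[OF PE] PE Pid P0 quad])
qed

text \<open>The choice for a single index j. The bound is phrased through \<alpha> w + h, which does
  not involve the map, so that the estimates for different j can be added.\<close>

lemma adapted_gaussian_exists:
  fixes l :: "'a::euclidean_space \<Rightarrow> 'b::euclidean_space"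
  assumes H: "subspace H" and F: "subspace F" and W: "subspace W" "W \<subseteq> H"
    and l: "linear_sub H F l" and \<alpha>: "0 < \<alpha>" "\<alpha> \<le> 1"
  shows "\<exists>B k d. orthonormal_basis_of F B \<and> (\<forall>b\<in>B. 0 < k b \<and> k b \<le> 1) \<and>
    d \<le> essential_rank \<alpha> W F l \<and> (\<Prod>b\<in>B. 1 / sqrt (k b)) = \<alpha> powr (- real d) \<and>
    (\<forall>w\<in>W. \<forall>h\<in>H. (\<forall>v\<in>W. v \<bullet> h = 0) \<longrightarrow>
      (\<Sum>b\<in>B. k b * (l (w + h) \<bullet> b)\<^sup>2) \<le> ((onorm_sub H l + 1) * norm (\<alpha> *\<^sub>R w + h))\<^sup>2)"
proof -
  obtain g where g: "linear g" and gl: "\<And>x. x \<in> H \<Longrightarrow> g x = l x"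
    using linear_sub_extends[OF H l] by blast
  have gF: "g x \<in> F" if "x \<in> H" for x using that l gl by (auto simp: linear_sub_def)
  have bound: "norm (g x) \<le> onorm_sub H l * norm x" if "x \<in> H" for x
    using onorm_sub_bound[OF g gl that] gl[OF that] by simp
  have gW: "g ` W \<subseteq> F" using gF W(2) by blast
  obtain W1 where W1: "subspace W1" "W1 \<subseteq> W" "dim W1 \<le> essential_rank \<alpha> W F g"
    and W1o: "\<And>u v. u \<in> W1 \<Longrightarrow> v \<in> W \<Longrightarrow> \<forall>w\<in>W1. w \<bullet> v = 0 \<Longrightarrow> g u \<bullet> g v = 0"
    and W1b: "\<And>v. v \<in> W \<Longrightarrow> \<forall>w\<in>W1. w \<bullet> v = 0 \<Longrightarrow> norm (g v) \<le> \<alpha> * norm v"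
    by (rule large_singular_subspace[OF W(1) g gW less_imp_le[OF \<alpha>(1)]], rule that) blast+
  have E: "subspace (g ` W1)" "g ` W1 \<subseteq> F"
    using g W1 W gF by (auto intro: linear_subspace_image)
  obtain B k P where B: "orthonormal_basis_of F B" and k: "\<And>b. b \<in> B \<Longrightarrow> 0 < k b \<and> k b \<le> 1"
    and prod: "(\<Prod>b\<in>B. 1 / sqrt (k b)) = \<alpha> powr (- real (dim (g ` W1)))"
    and P: "linear P" "\<And>y z. P y \<bullet> (z - P z) = 0" "\<And>y. P y \<in> g ` W1"
      "\<And>y. y \<in> g ` W1 \<Longrightarrow> P y = y"
      "\<And>y. \<forall>e\<in>g ` W1. e \<bullet> y = 0 \<Longrightarrow> P y = 0"
    and quad: "\<And>y. y \<in> F \<Longrightarrow> (\<Sum>b\<in>B. k b * (y \<bullet> b)\<^sup>2) = (norm (\<alpha> *\<^sub>R P y + (y - P y)))\<^sup>2"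
    by (rule adapted_basis[OF F E \<alpha>], rule that) blast+
  have "dim (g ` W1) \<le> essential_rank \<alpha> W F l"
    using dim_image_le[OF g, of W1] W1(3) essential_rank_cong[of W g l \<alpha> F] gl W(2) by force
  moreover have "(\<Sum>b\<in>B. k b * (l (w + h) \<bullet> b)\<^sup>2) \<le> ((onorm_sub H l + 1) * norm (\<alpha> *\<^sub>R w + h))\<^sup>2"
    if w: "w \<in> W" and h: "h \<in> H" "\<forall>v\<in>W. v \<bullet> h = 0" for w h
  proof -
    \<comment> \<open>Unlike the splitting into \<open>w\<close> and \<open>h\<close>, this finer
      one depends on \<open>l\<close>.\<close>
    obtain w1 w2 where w1: "w1 \<in> span W1" and w2o: "\<And>v. v \<in> span W1 \<Longrightarrow> orthogonal w2 v"
      and w12: "w = w1 + w2"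
      using orthogonal_subspace_decomp_exists[of W1 w] by blast
    have span: "span W1 = W1" using W1(1) by (simp add: span_eq_iff)
    have w1W: "w1 \<in> W1" "w1 \<in> W" "w1 \<in> H" using w1 span W1 W by auto
    have w2W: "w2 \<in> W" using subspace_diff[OF W(1) w w1W(2)] by (simp add: w12)
    have o: "\<forall>v\<in>W1. v \<bullet> w2 = 0"
      using w2o span by (simp add: orthogonal_def inner_commute)
    have xH: "w + h \<in> H" using w h W H by (auto intro: subspace_add)
    have "norm (\<alpha> *\<^sub>R P (g (w1 + w2 + h)) + (g (w1 + w2 + h) - P (g (w1 + w2 + h))))
        \<le> (onorm_sub H l + 1) * norm (\<alpha> *\<^sub>R (w1 + w2) + h)"
    proof (rule norm_weighted_image_le[OF g P(1,2) _ _ _ _ _ _ \<alpha> onorm_sub_nonneg[OF H l]])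
      show "w1 \<bullet> w2 = 0" using o w1W by simp
      show "w1 \<bullet> h = 0" "w2 \<bullet> h = 0" using h w1W w2W by auto
      show "P (g w1) = g w1" using P(4) w1W by simp
      show "P (g w2) = 0" using W1o[OF _ w2W o] by (intro P(5)) auto
      show "norm (g w2) \<le> \<alpha> * norm w2" using W1b[OF w2W o] by simp
      show "norm (g (\<alpha> *\<^sub>R w1 + h)) \<le> onorm_sub H l * norm (\<alpha> *\<^sub>R w1 + h)"
        "norm (g (\<alpha> *\<^sub>R w1 - h)) \<le> onorm_sub H l * norm (\<alpha> *\<^sub>R w1 - h)"
        using w1W h H by (auto intro!: bound subspace_add subspace_diff subspace_scale)
    qed
    then have "(norm (\<alpha> *\<^sub>R P (g (w + h)) + (g (w + h) - P (g (w + h)))))\<^sup>2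
        \<le> ((onorm_sub H l + 1) * norm (\<alpha> *\<^sub>R w + h))\<^sup>2"
      unfolding w12 by (intro power_mono) auto
    then show ?thesis using quad[OF gF[OF xH]] gl[OF xH] by simp
  qed
  ultimately show ?thesis
    using B k prod by (intro exI[of _ B] exI[of _ k] exI[of _ "dim (g ` W1)"]) simp
qed

subsection \<open>The lower bound\<close>

theorem theorem1p5:
  fixes J :: "'j set"
    and H :: "'a::euclidean_space set"
    and K :: "'j \<Rightarrow> 'b::euclidean_space set"
    and l :: "'j \<Rightarrow> 'a \<Rightarrow> 'b"
    and q :: "'j \<Rightarrow> real"
    and C t \<alpha> :: real
    and W :: "'a set"
  assumes "brascamp_lieb_datum J H K l q"
    and "C = 1 + Sup (insert 0 ((\<lambda>j. onorm_sub H (l j)) ` J))"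
    and "t > 0"
    and "0 < \<alpha>" and "\<alpha> \<le> 1"
    and "subspace W" and "W \<subseteq> H"
  shows "brascamp_lieb_const J H K l q (\<lambda>j. id) (\<lambda>x. t *\<^sub>R x) \<ge>
    ennreal (((C / \<alpha>)\<^sup>2 * t + C\<^sup>2 * (\<Sum>j\<in>J. q j)) powr (- real (dim H) / 2) *
      \<alpha> powr ((\<Sum>j\<in>J. q j * real (essential_rank \<alpha> W (K j) (l j))) - real (dim W)))"
proof -
  have J: "finite J" and H: "subspace H" and K: "\<And>j. j \<in> J \<Longrightarrow> subspace (K j)"
    and l: "\<And>j. j \<in> J \<Longrightarrow> linear_sub H (K j) (l j)" and q: "\<And>j. j \<in> J \<Longrightarrow> 0 < q j"
    using assms(1) by (auto simp: brascamp_lieb_datum_def)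
  note \<alpha> = assms(4,5)
  let ?r = "\<lambda>j. essential_rank \<alpha> W (K j) (l j)"
  let ?n = "\<lambda>j. onorm_sub H (l j)"
  have C: "0 \<le> ?n j + 1 \<and> ?n j + 1 \<le> C" if "j \<in> J" for j
  proof -
    have "?n j \<le> Sup (insert 0 (?n ` J))" using J that by (intro cSup_upper) auto
    moreover have "0 \<le> ?n j" using l[OF that] H by (blast intro: onorm_sub_nonneg)
    ultimately show ?thesis using assms(2) by simp
  qed
  \<comment> \<open>The inserted 0 gives C at least 1 even when \<open>J\<close> is empty.\<close>
  have "0 \<le> Sup (insert 0 (?n ` J))" using J by (intro cSup_upper) auto
  then have "1 \<le> C" using assms(2) by simp
  define M where "M = (C / \<alpha>)\<^sup>2 * t + C\<^sup>2 * (\<Sum>j\<in>J. q j)"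
  have "0 < (C / \<alpha>)\<^sup>2 * t" using \<open>1 \<le> C\<close> \<alpha> assms(3) by simp
  moreover have "0 \<le> C\<^sup>2 * (\<Sum>j\<in>J. q j)" using q by (intro mult_nonneg_nonneg sum_nonneg) (auto intro: less_imp_le)
  ultimately have "0 < M" unfolding M_def by linarith
  have "\<forall>j\<in>J. \<exists>B k d. orthonormal_basis_of (K j) B \<and> (\<forall>b\<in>B. 0 < k b \<and> k b \<le> 1) \<and>
    d \<le> ?r j \<and> (\<Prod>b\<in>B. 1 / sqrt (k b)) = \<alpha> powr (- real d) \<and>
    (\<forall>w\<in>W. \<forall>h\<in>H. (\<forall>v\<in>W. v \<bullet> h = 0) \<longrightarrow>
      (\<Sum>b\<in>B. k b * (l j (w + h) \<bullet> b)\<^sup>2) \<le> ((?n j + 1) * norm (\<alpha> *\<^sub>R w + h))\<^sup>2)"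
    (is "\<forall>j\<in>J. \<exists>B k d. ?\<Phi> j B k d")
    using adapted_gaussian_exists[OF H K assms(6,7) l \<alpha>] by blast
  then obtain B where "\<forall>j\<in>J. \<exists>k d. ?\<Phi> j (B j) k d"
    using bchoice[of J "\<lambda>j B. \<exists>k d. ?\<Phi> j B k d"] by blast
  then obtain k where "\<forall>j\<in>J. \<exists>d. ?\<Phi> j (B j) (k j) d"
    using bchoice[of J "\<lambda>j k. \<exists>d. ?\<Phi> j (B j) k d"] by blast
  then obtain d where "\<forall>j\<in>J. ?\<Phi> j (B j) (k j) (d j)"
    using bchoice[of J "\<lambda>j d. ?\<Phi> j (B j) (k j) d"] by blast
  then have B: "orthonormal_basis_of (K j) (B j)" and k: "\<And>b. b \<in> B j \<Longrightarrow> 0 < k j b \<and> k j b \<le> 1"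
    and d: "d j \<le> ?r j" and prod: "(\<Prod>b\<in>B j. 1 / sqrt (k j b)) = \<alpha> powr (- real (d j))"
    and quad: "\<And>w h. w \<in> W \<Longrightarrow> h \<in> H \<Longrightarrow> \<forall>v\<in>W. v \<bullet> h = 0 \<Longrightarrow>
      (\<Sum>b\<in>B j. k j b * (l j (w + h) \<bullet> b)\<^sup>2) \<le> ((?n j + 1) * norm (\<alpha> *\<^sub>R w + h))\<^sup>2"
    if "j \<in> J" for j
    using that by simp_all
  obtain A m P where A: "orthonormal_basis_of H A" and m: "\<And>b. b \<in> A \<Longrightarrow> 0 < m b \<and> m b \<le> 1"
    and prodA: "(\<Prod>b\<in>A. 1 / sqrt (m b)) = \<alpha> powr (- real (dim W))"
    and P: "linear P" "\<And>y z. P y \<bullet> (z - P z) = 0" "\<And>y. P y \<in> W" "\<And>y. y \<in> W \<Longrightarrow> P y = y"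
      "\<And>y. \<forall>e\<in>W. e \<bullet> y = 0 \<Longrightarrow> P y = 0"
    and quadA: "\<And>y. y \<in> H \<Longrightarrow> (\<Sum>b\<in>A. m b * (y \<bullet> b)\<^sup>2) = (norm (\<alpha> *\<^sub>R P y + (y - P y)))\<^sup>2"
    by (rule adapted_basis[OF H assms(6,7) \<alpha>], rule that) blast+
  define f where "f j y = exp (- pi * (\<Sum>b\<in>B j. k j b * (y \<bullet> b)\<^sup>2))" for j y
  define D where "D = (\<Sum>j\<in>J. q j * real (d j))"
  let ?I = "\<integral>\<^sup>+x. ennreal (gauss_chi (\<lambda>x. t *\<^sub>R x) x * (\<Prod>j\<in>J. f j (l j x) powr q j)) \<partial>lebesgue_sub H"
  have pointwise: "exp (- pi * (\<Sum>b\<in>A. M * m b * (x \<bullet> b)\<^sup>2))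
      \<le> gauss_chi (\<lambda>x. t *\<^sub>R x) x * (\<Prod>j\<in>J. f j (l j x) powr q j)" if x: "x \<in> H" for x
  proof -
    define u where "u = \<alpha> *\<^sub>R P x + (x - P x)"
    have h: "x - P x \<in> H" "\<forall>v\<in>W. v \<bullet> (x - P x) = 0"
      using x P(3)[of x] assms(7) H P(2)[of _ x] P(4) by (auto intro: subspace_diff) metis
    \<comment> \<open>Here \<open>u\<close> is S x. Shrinking by \<alpha> on \<open>W\<close> gives
      the factor \<open>1 / \<alpha>\<close>, which C at least 1 enlarges to the one in
      \<open>M\<close>.\<close>
    have "t * (norm x)\<^sup>2 \<le> (C / \<alpha>)\<^sup>2 * t * (norm u)\<^sup>2"
    proof -
      have "\<alpha>\<^sup>2 * (norm x)\<^sup>2 = \<alpha>\<^sup>2 * (norm (P x))\<^sup>2 + \<alpha>\<^sup>2 * (norm (x - P x))\<^sup>2"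
        using P(2)[of x x] by (simp add: power2_norm_eq_inner inner_diff_left inner_diff_right
            inner_commute algebra_simps)
      also have "\<dots> \<le> \<alpha>\<^sup>2 * (norm (P x))\<^sup>2 + 1 * (norm (x - P x))\<^sup>2"
        using \<alpha> by (intro add_mono mult_right_mono) (auto simp: power_le_one)
      also have "\<dots> = (norm u)\<^sup>2"
        using P(2)[of x x] unfolding u_def power2_norm_eq_inner
        by (simp add: inner_add_left inner_add_right inner_commute power2_eq_square)
      finally have "(norm x)\<^sup>2 \<le> (1 / \<alpha>)\<^sup>2 * (norm u)\<^sup>2"
        using \<alpha> by (simp add: field_simps)
      also have "\<dots> \<le> (C / \<alpha>)\<^sup>2 * (norm u)\<^sup>2"
        using \<alpha> \<open>1 \<le> C\<close> by (intro mult_right_mono power_mono divide_right_mono) auto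
      finally show ?thesis using assms(3) by (simp add: mult_ac)
    qed
    moreover have "(\<Sum>j\<in>J. q j * (\<Sum>b\<in>B j. k j b * (l j x \<bullet> b)\<^sup>2)) \<le> (\<Sum>j\<in>J. q j * (C\<^sup>2 * (norm u)\<^sup>2))"
    proof (intro sum_mono mult_left_mono)
      fix j assume j: "j \<in> J"
      have "(\<Sum>b\<in>B j. k j b * (l j x \<bullet> b)\<^sup>2) \<le> ((?n j + 1) * norm u)\<^sup>2"
        using quad[OF j P(3)[of x] h] by (simp add: u_def)
      also have "\<dots> \<le> (C * norm u)\<^sup>2" using C[OF j] by (intro power_mono mult_right_mono) auto
      finally show "(\<Sum>b\<in>B j. k j b * (l j x \<bullet> b)\<^sup>2) \<le> C\<^sup>2 * (norm u)\<^sup>2"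
        by (simp add: power_mult_distrib)
    qed (use q in \<open>auto intro: less_imp_le\<close>)
    ultimately have "t * (norm x)\<^sup>2 + (\<Sum>j\<in>J. q j * (\<Sum>b\<in>B j. k j b * (l j x \<bullet> b)\<^sup>2)) \<le> M * (norm u)\<^sup>2"
      unfolding M_def by (simp add: sum_distrib_right[symmetric] sum_distrib_left[symmetric] algebra_simps)
    also have "\<dots> = (\<Sum>b\<in>A. M * m b * (x \<bullet> b)\<^sup>2)"
      unfolding u_def quadA[OF x, symmetric] by (simp add: sum_distrib_left mult.assoc)
    finally have "- pi * (\<Sum>b\<in>A. M * m b * (x \<bullet> b)\<^sup>2)
        \<le> - pi * (t * (norm x)\<^sup>2 + (\<Sum>j\<in>J. q j * (\<Sum>b\<in>B j. k j b * (l j x \<bullet> b)\<^sup>2)))"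
      by (simp add: mult_left_mono)
    then have "exp (- pi * (\<Sum>b\<in>A. M * m b * (x \<bullet> b)\<^sup>2))
        \<le> exp (- pi * (t * (norm x)\<^sup>2 + (\<Sum>j\<in>J. q j * (\<Sum>b\<in>B j. k j b * (l j x \<bullet> b)\<^sup>2))))"
      by (rule exp_mono)
    also have "\<dots> = gauss_chi (\<lambda>x. t *\<^sub>R x) x * (\<Prod>j\<in>J. f j (l j x) powr q j)"
      using J unfolding gauss_chi_def f_def
      by (simp add: powr_def exp_sum[symmetric] exp_add[symmetric] power2_norm_eq_inner
          sum_negf sum_distrib_left distrib_left mult_ac)
    finally show ?thesis .
  qed
  have "(\<Prod>b\<in>A. 1 / sqrt (M * m b)) = (1 / sqrt M) ^ dim H * \<alpha> powr (- real (dim W))"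
    by (simp add: real_sqrt_mult prod.distrib[symmetric] prodA[symmetric] onb_card[OF A, symmetric]
        prod_constant[symmetric] del: prod_constant)
  also have "(1 / sqrt M) ^ dim H = M powr (- real (dim H) / 2)"
  proof -
    have "1 / sqrt M = M powr (- (1 / 2))"
      using \<open>0 < M\<close> by (simp add: powr_minus_divide powr_half_sqrt)
    then show ?thesis using \<open>0 < M\<close> by (simp add: powr_realpow[symmetric] powr_powr)
  qed
  finally have "ennreal (M powr (- real (dim H) / 2) * \<alpha> powr (- real (dim W)))
      = (\<integral>\<^sup>+x. ennreal (exp (- pi * (\<Sum>b\<in>A. M * m b * (x \<bullet> b)\<^sup>2))) \<partial>lebesgue_sub H)"
    using m \<open>0 < M\<close> by (subst nn_integral_lebesgue_sub_gauss[OF A]) auto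
  also have "\<dots> \<le> ?I"
    using pointwise by (intro nn_integral_mono ennreal_leI) (simp add: space_lebesgue_sub)
  finally have lower: "ennreal (M powr (- real (dim H) / 2) * \<alpha> powr (- real (dim W))) \<le> ?I" .
  have type: "\<forall>j\<in>J. of_type (K j) id (f j)"
    unfolding f_def[abs_def] using of_type_id_gauss[OF B k] by simp
  have masses: "(\<Prod>j\<in>J. ennreal_powr (\<integral>\<^sup>+y. ennreal (f j y) \<partial>lebesgue_sub (K j)) (q j))
      = ennreal (\<alpha> powr (- D))"
  proof -
    have "ennreal_powr (\<integral>\<^sup>+y. ennreal (f j y) \<partial>lebesgue_sub (K j)) (q j)
        = ennreal (\<alpha> powr (- (q j * real (d j))))" if "j \<in> J" for j
    proof -
      have "(\<integral>\<^sup>+y. ennreal (f j y) \<partial>lebesgue_sub (K j)) = ennreal (\<alpha> powr (- real (d j)))"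
        unfolding f_def prod[OF that, symmetric]
        using k[OF that] by (intro nn_integral_lebesgue_sub_gauss[OF B[OF that]]) simp
      then show ?thesis by (simp add: ennreal_powr_def powr_powr mult.commute)
    qed
    then have "(\<Prod>j\<in>J. ennreal_powr (\<integral>\<^sup>+y. ennreal (f j y) \<partial>lebesgue_sub (K j)) (q j))
        = ennreal (\<Prod>j\<in>J. \<alpha> powr (- (q j * real (d j))))"
      by (simp add: prod_ennreal)
    also have "(\<Prod>j\<in>J. \<alpha> powr (- (q j * real (d j)))) = \<alpha> powr (- D)"
      using \<alpha> J by (simp add: powr_def exp_sum[symmetric] D_def sum_distrib_right sum_negf)
    finally show ?thesis .
  qed
  have "D \<le> (\<Sum>j\<in>J. q j * real (?r j))"
    unfolding D_def using d q by (intro sum_mono mult_left_mono) (auto intro: less_imp_le)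
  \<comment> \<open>The base is at most 1, so raising the exponent lowers the power.\<close>
  then have "\<alpha> powr ((\<Sum>j\<in>J. q j * real (?r j)) - real (dim W)) \<le> \<alpha> powr (D - real (dim W))"
    using \<alpha> by (intro powr_mono') auto
  also have "\<dots> = \<alpha> powr (- real (dim W)) * \<alpha> powr D"
    by (simp add: powr_add[symmetric])
  finally have "M powr (- real (dim H) / 2) * \<alpha> powr ((\<Sum>j\<in>J. q j * real (?r j)) - real (dim W))
      \<le> (M powr (- real (dim H) / 2) * \<alpha> powr (- real (dim W))) * \<alpha> powr D"
    by (simp add: mult.assoc mult_left_mono)
  then have target: "ennreal (M powr (- real (dim H) / 2) * \<alpha> powr ((\<Sum>j\<in>J. q j * real (?r j)) - real (dim W)))
      \<le> ennreal (M powr (- real (dim H) / 2) * \<alpha> powr (- real (dim W))) * ennreal (\<alpha> powr D)"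
    by (simp add: ennreal_mult[symmetric] ennreal_leI)
  show ?thesis
    unfolding brascamp_lieb_const_def M_def[symmetric]
  proof (rule Inf_greatest)
    fix c
    assume "c \<in> {c. \<forall>f. (\<forall>j\<in>J. of_type (K j) id (f j)) \<longrightarrow>
      (\<integral>\<^sup>+x. ennreal (gauss_chi (\<lambda>x. t *\<^sub>R x) x * (\<Prod>j\<in>J. f j (l j x) powr q j)) \<partial>lebesgue_sub H)
       \<le> c * (\<Prod>j\<in>J. ennreal_powr (\<integral>\<^sup>+y. ennreal (f j y) \<partial>lebesgue_sub (K j)) (q j))}"
    with type have "?I \<le> c * ennreal (\<alpha> powr (- D))" unfolding masses[symmetric] by blast
    note target
    \<comment> \<open>Multiplying by the inverse of the masses, rather than dividing, also covers an
      infinite \<open>c\<close>.\<close>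
    also have "ennreal (M powr (- real (dim H) / 2) * \<alpha> powr (- real (dim W))) * ennreal (\<alpha> powr D)
        \<le> c * ennreal (\<alpha> powr (- D)) * ennreal (\<alpha> powr D)"
      using order_trans[OF lower \<open>?I \<le> _\<close>] by (rule mult_right_mono) simp
    also have "\<dots> = c"
      using \<alpha> by (simp add: mult.assoc ennreal_mult[symmetric] powr_add[symmetric])
    finally show "ennreal (M powr (- real (dim H) / 2) *
        \<alpha> powr ((\<Sum>j\<in>J. q j * real (?r j)) - real (dim W))) \<le> c" .
  qed
qed

end
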